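(* Let $n\ge 3$, let $a_1,a_2$ be positive integers with $a_1+a_2=n$, and let $\Lambda=B\Lambda_{a_1,a_2}$ be the corresponding $2$-block diagonal matching field of size $3\times n$. Then $\Lambda$ produces a toric degeneration of $\mathrm{Gr}(3,n)$: $\Lambda$ is coherent, and for every weight matrix $M\in\mathbb{R}^{3\times n}$ inducing $\Lambda$ the initial ideal $\mathrm{in}_{w_M}(\mathcal{I}_{3,n})$ of the Plücker ideal is prime and binomial. Equivalently, the Plücker forms $\{P_I\}_{I\in\mathbf{I}_{3,n}}$ are a Khovanskii basis of the Plücker algebra $\mathcal{A}_{3,n}$ with respect to every weight matrix $M$ inducing $\Lambda$.
   Context: Fix a field $\mathbb{K}$. Write $[n]=\{1,\dots,n\}$ and let $\mathbf{I}_{3,n}$ be the set of $3$-element subsets of $[n]$. Plücker ideal and algebra: let $X=(x_{ij})$ be a $3\times n$ matrix of indeterminates and $X_I$ the submatrix with columns $I\in\mathbf{I}_{3,n}$. The Plücker ideal $\mathcal{I}_{3,n}\subset\mathbb{K}[P_I : I\in\mathbf{I}_{3,n}]$ is the kernel of $\mathbb{K}[P_I]\to\mathbb{K}[x_{ij}]$, $P_I\mapsto\det(X_I)$. The symbol $P_I$ is also used for the Plücker form $\det(X_I)$. The Plücker algebra is $\mathcal{A}_{3,n}=\mathbb{K}[P_I]/\mathcal{I}_{3,n}$, identified with the subalgebra of $\mathbb{K}[x_{ij}]$ generated by the forms $\det(X_I)$. Matching fields: a $3\times n$ matching field is a map $\Lambda:\mathbf{I}_{3,n}\to S_3$. For $I=\{i_1<i_2<i_3\}$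 and $\sigma=\Lambda(I)$ put $\mathbf{x}_{\Lambda(I)}=x_{\sigma(1)i_1}x_{\sigma(2)i_2}x_{\sigma(3)i_3}$. A matrix $M=(a_{ij})\in\mathbb{R}^{3\times n}$ assigns weight $a_{ij}$ to $x_{ij}$; $\mathrm{in}_M(f)$ is the sum of all terms of $f$ of lowest weight. $\Lambda$ is coherent if there is $M$ with $\mathrm{in}_M(P_I)=\mathrm{sgn}(\Lambda(I))\,\mathbf{x}_{\Lambda(I)}$ for all $I$; then $M$ induces $\Lambda$. The weight $w_M$ on the variables $P_I$ assigns to $P_I$ the $M$-weight of $\mathrm{in}_M(\det X_I)$, and $\mathrm{in}_{w_M}(\mathcal{I}_{3,n})$ is the ideal generated by the lowest-$w_M$-weight forms of the elements of $\mathcal{I}_{3,n}$. Khovanskii basis: the Plücker forms are a Khovanskii basis of $\mathcal{A}_{3,n}$ with respect to $M$ if every $\mathrm{in}_M(P_I)$ is a monomial (up to sign) and the initial algebra of $\mathcal{A}_{3,n}$ (the $\mathbb{K}$-span of all $\mathrm{in}_M(f)$, $f\in\mathcal{A}_{3,n}\subset\mathbb{K}[x_{ij}]$) equals $\mathbb{K}[\mathrm{in}_M(P_I) : I\in\mathbf{I}_{3,n}]$. $2$-block diagonal matching field: let $I_1=\{1,\dots,a_1\}$ and $I_2=\{a_1+1,\dots,n\}$. For $I\in\mathbf{I}_{3,n}$ let $s$ be the minimal $t\in\{1,2\}$ with $I_t\cap I\ne\emptyset$. Then $B\Lambda_{a_1,a_2}(I)=\mathrm{id}$ if $|I\cap I_s|\ge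 2$, and $B\Lambda_{a_1,a_2}(I)=(12)$ (the transposition of $1$ and $2$) if $|I\cap I_s|=1$. *)

theory Defs
  imports
    "HOL-Library.Poly_Mapping"
    "HOL-Combinatorics.Permutations"
    "HOL-Algebra.Ideal"
    "Jordan_Normal_Form.Determinant"
begin

section \<open>Multivariate polynomials\<close>

text \<open>Polynomials over \<^typ>\<open>'k\<close> in the variables \<^typ>\<open>'v\<close>, as finitely supported maps from
  exponent vectors to coefficients.\<close>

type_synonym ('v, 'k) mpoly = "('v \<Rightarrow>\<^sub>0 nat) \<Rightarrow>\<^sub>0 'k"

definition Const :: "'k::field \<Rightarrow> ('v, 'k) mpoly" where
  "Const c = Poly_Mapping.single 0 c"

definition Var :: "'v \<Rightarrow> ('v, 'k::field) mpoly" where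
  "Var v = Poly_Mapping.single (Poly_Mapping.single v 1) 1"

definition vars :: "('v, 'k::field) mpoly \<Rightarrow> 'v set" where
  "vars p = (\<Union>m\<in>Poly_Mapping.keys p. Poly_Mapping.keys m)"

definition poly_ring :: "'v set \<Rightarrow> ('v, 'k::field) mpoly ring" where
  "poly_ring V = \<lparr>carrier = {p. vars p \<subseteq> V}, monoid.mult = (*), one = 1, ring.zero = 0, add = (+)\<rparr>"

text \<open>The \<^typ>\<open>'k\<close>-algebra homomorphism sending each variable \<open>v\<close> to \<open>\<phi> v\<close>.\<close>

definition subst :: "('v \<Rightarrow> ('u, 'k) mpoly) \<Rightarrow> ('v, 'k::field) mpoly \<Rightarrow> ('u, 'k) mpoly" where
  "subst \<phi> p = (\<Sum>m\<in>Poly_Mapping.keys p. Const (Poly_Mapping.lookup p m) * (\<Prod>v\<in>Poly_Mapping.keys m. \<phi> v ^ Poly_Mapping.lookup m v))"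

text \<open>The subalgebra generated by the family \<open>(\<phi> v)\<close>, \<open>v \<in> V\<close>.\<close>

definition subalg :: "('v \<Rightarrow> ('u, 'k::field) mpoly) \<Rightarrow> 'v set \<Rightarrow> ('u, 'k) mpoly set" where
  "subalg \<phi> V = subst \<phi> ` carrier (poly_ring V)"

definition scale :: "'k::field \<Rightarrow> ('v, 'k) mpoly \<Rightarrow> ('v, 'k) mpoly" where
  "scale c p = Const c * p"

interpretation mpoly: Vector_Spaces.vector_space scale
  by unfold_locales
    (simp_all add: scale_def Const_def single_add mult_single distrib_left distrib_right
      mult.assoc [symmetric])

section \<open>Initial forms and initial ideals\<close>

definition mon_weight :: "('v \<Rightarrow> real) \<Rightarrow> ('v \<Rightarrow>\<^sub>0 nat) \<Rightarrow> real" where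
  "mon_weight w m = (\<Sum>v\<in>Poly_Mapping.keys m. w v * real (Poly_Mapping.lookup m v))"

definition init_form :: "('v \<Rightarrow> real) \<Rightarrow> ('v, 'k::field) mpoly \<Rightarrow> ('v, 'k) mpoly" where
  "init_form w p =
     (\<Sum>m\<in>{m \<in> Poly_Mapping.keys p. \<forall>m'\<in>Poly_Mapping.keys p. mon_weight w m \<le> mon_weight w m'}.
        Poly_Mapping.single m (Poly_Mapping.lookup p m))"

text \<open>Only meaningful for nonzero \<open>p\<close>.\<close>

definition form_weight :: "('v \<Rightarrow> real) \<Rightarrow> ('v, 'k::field) mpoly \<Rightarrow> real" where
  "form_weight w p = Min (mon_weight w ` Poly_Mapping.keys p)"

definition init_ideal ::
  "'v set \<Rightarrow> ('v \<Rightarrow> real) \<Rightarrow> ('v, 'k::field) mpoly set \<Rightarrow> ('v, 'k) mpoly set" where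
  "init_ideal V w J = genideal (poly_ring V) (init_form w ` J)"

text \<open>A binomial has exactly two terms; the zero ideal is a binomial ideal, generated by the
  empty set.\<close>

definition is_binomial :: "('v, 'k::field) mpoly \<Rightarrow> bool" where
  "is_binomial p \<longleftrightarrow> card (Poly_Mapping.keys p) = 2"

definition binomial_ideal :: "'v set \<Rightarrow> ('v, 'k::field) mpoly set \<Rightarrow> bool" where
  "binomial_ideal V J \<longleftrightarrow>
     (\<exists>B \<subseteq> carrier (poly_ring V). (\<forall>b\<in>B. is_binomial b) \<and> J = genideal (poly_ring V) B)"

section \<open>The Pluecker algebra\<close>

definition triples :: "nat \<Rightarrow> nat set set" where
  "triples n = {I. I \<subseteq> {1..n} \<and> card I = 3}"

definition matrix_vars :: "nat \<Rightarrow> (nat \<times> nat) set" where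
  "matrix_vars n = {1..3} \<times> {1..n}"

text \<open>\<open>col I k\<close> is the \<open>k\<close>-th smallest element of \<open>I\<close>, counting from 1.\<close>

definition col :: "nat set \<Rightarrow> nat \<Rightarrow> nat" where
  "col I k = sorted_list_of_set I ! (k - 1)"

text \<open>The indices of \<^const>\<open>mat\<close> start at 0, those of the variables at 1.\<close>

definition plucker_form :: "nat set \<Rightarrow> (nat \<times> nat, 'k::field) mpoly" where
  "plucker_form I = Determinant.det (mat 3 3 (\<lambda>(i, k). Var (i + 1, col I (k + 1))))"

definition plucker_ideal :: "nat \<Rightarrow> (nat set, 'k::field) mpoly set" where
  "plucker_ideal n =
     a_kernel (poly_ring (triples n)) (poly_ring (matrix_vars n)) (subst plucker_form)"

definition plucker_algebra :: "nat \<Rightarrow> (nat \<times> nat, 'k::field) mpoly set" where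
  "plucker_algebra n = subalg plucker_form (triples n)"

section \<open>Matching fields\<close>

text \<open>Elements of the symmetric group are functions on \<^typ>\<open>nat\<close> permuting \<open>{1..3}\<close>.
  Only the values on \<^term>\<open>triples n\<close> matter.\<close>

type_synonym matching_field = "nat set \<Rightarrow> nat \<Rightarrow> nat"

definition is_matching_field :: "nat \<Rightarrow> matching_field \<Rightarrow> bool" where
  "is_matching_field n \<Lambda> \<longleftrightarrow> (\<forall>I\<in>triples n. \<Lambda> I permutes {1..3})"

definition mf_monomial :: "matching_field \<Rightarrow> nat set \<Rightarrow> (nat \<times> nat, 'k::field) mpoly" where
  "mf_monomial \<Lambda> I = (\<Prod>k\<in>{1..3}. Var (\<Lambda> I k, col I k))"

text \<open>A weight matrix \<open>M\<close> gives \<open>x\<^sub>i\<^sub>j\<close> the weight \<open>M i j\<close>; entries outside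
  \<open>{1..3} \<times> {1..n}\<close> are irrelevant.  The coefficient field enters only through the
  coefficients of the Pluecker forms and is passed as a type argument.\<close>

type_synonym weight_matrix = "nat \<Rightarrow> nat \<Rightarrow> real"

definition induces :: "'k::field itself \<Rightarrow> nat \<Rightarrow> weight_matrix \<Rightarrow> matching_field \<Rightarrow> bool" where
  "induces K n M \<Lambda> \<longleftrightarrow>
     (\<forall>I\<in>triples n. init_form (case_prod M) (plucker_form I :: (nat \<times> nat, 'k) mpoly)
        = of_int (sign (\<Lambda> I)) * mf_monomial \<Lambda> I)"

definition coherent :: "'k::field itself \<Rightarrow> nat \<Rightarrow> matching_field \<Rightarrow> bool" where
  "coherent K n \<Lambda> \<longleftrightarrow> is_matching_field n \<Lambda> \<and> (\<exists>M. induces K n M \<Lambda>)"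

definition plucker_weight :: "'k::field itself \<Rightarrow> weight_matrix \<Rightarrow> nat set \<Rightarrow> real" where
  "plucker_weight K M I =
     form_weight (case_prod M)
       (init_form (case_prod M) (plucker_form I :: (nat \<times> nat, 'k) mpoly))"

definition init_plucker_ideal :: "nat \<Rightarrow> weight_matrix \<Rightarrow> (nat set, 'k::field) mpoly set" where
  "init_plucker_ideal n M =
     init_ideal (triples n) (plucker_weight TYPE('k) M) (plucker_ideal n)"

definition is_monomial_up_to_sign :: "('v, 'k::field) mpoly \<Rightarrow> bool" where
  "is_monomial_up_to_sign p \<longleftrightarrow>
     (\<exists>m. p = Poly_Mapping.single m 1 \<or> p = Poly_Mapping.single m (- 1))"

definition plucker_khovanskii :: "'k::field itself \<Rightarrow> nat \<Rightarrow> weight_matrix \<Rightarrow> bool" where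
  "plucker_khovanskii K n M \<longleftrightarrow>
     (\<forall>I\<in>triples n.
        is_monomial_up_to_sign
          (init_form (case_prod M) (plucker_form I :: (nat \<times> nat, 'k) mpoly))) \<and>
     mpoly.span (init_form (case_prod M) ` (plucker_algebra n :: (nat \<times> nat, 'k) mpoly set))
       = subalg (\<lambda>I. init_form (case_prod M) (plucker_form I)) (triples n)"

section \<open>Block diagonal matching fields\<close>

definition block :: "nat \<Rightarrow> nat \<Rightarrow> nat \<Rightarrow> nat set" where
  "block a1 a2 t = (if t = 1 then {1..a1} else {a1 + 1..a1 + a2})"

text \<open>For a triple \<open>I\<close>, the last case is that of exactly one element in the block.\<close>

definition block_diagonal :: "nat \<Rightarrow> nat \<Rightarrow> matching_field" where
  "block_diagonal a1 a2 I =
     (let s = (LEAST t. t \<in> {1, 2} \<and> block a1 a2 t \<inter> I \<noteq> {})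
      in if card (I \<inter> block a1 a2 s) \<ge> 2 then id else Transposition.transpose 1 2)"

end

theory Submission
  imports Defs "HOL-Algebra.RingHom" "HOL-Library.Product_Lexorder"
begin

text \<open>Write a triple as the column \<open>(p, q, r)\<close> that lists its entries in the rows assigned to them by
the matching field.  For the block diagonal field with first block \<open>{1..a}\<close> these columns are given
by three inequalities: \<open>r\<close> exceeds \<open>p\<close> and \<open>q\<close>, and \<open>p\<close> comes before \<open>q\<close> in the order that
puts \<open>a + 1, \<dots>, n\<close> before \<open>1, \<dots>, a\<close> (\<open>columns\<close>, \<open>induces_iff\<close>).  The determinant \<open>col_det\<close>
whose columns are taken in that order is the Pluecker form up to sign, and a weight matrix induces the
field precisely when, for every column, the monomial of the main diagonal is the initial form of this
determinant.  So signs disappear, and all that is used of the weights is that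
each \<open>col_det c\<close> has the leading exponent \<open>col_exp c\<close>.

The exponent of a product of columns only records which entries occur in each of the three rows.  Two
facts carry the proof.

\<^item> Two collections of columns with the same row contents are linked by steps that swap the entries of
two columns in one row, through collections of columns (\<open>swap_connected_if_same_rows\<close>).  Swaps can always
produce a column that depends only on the row contents; this column is split off and induction applies.
In other words, the toric ideal of the matching field is generated by these quadratic swaps.

\<^item> Each such swap lifts to the Pluecker algebra.  By an exchange relation the two
products of determinants differ by a sum of two further products (\<open>exchange_entry1\<close> and its
companions).  The left side has cancelling leading terms, so all its exponents are strictly heavier than
them; if the two products on the right have different leading exponents, neither can hide the other, and
both are strictly heavier as well (\<open>leads_scale_sum_above\<close>).  That the exponents differ can be read off from
the third row, which always holds the largest entry of a column, provided that the side from which the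
entry is exchanged is chosen well.

Hence any two products of columns with the same exponent agree modulo heavier products
(\<open>equal_exps_in_higher\<close>).  Everything else is formal.  There are finitely many collections of a given
size, so every element of the Pluecker algebra is a combination of products with pairwise different
leading exponents, one chosen for each exponent; its initial form is then a combination of the corresponding
monomials, which is the Khovanskii basis property.  Likewise each binomial in the kernel of \<open>P\<^sub>I \<mapsto> in(P\<^sub>I)\<close> is
corrected by heavier terms to an element of the Pluecker ideal.  So the initial ideal is this
kernel, which is prime because the polynomial ring is a domain, and is generated by binomials.

Coherence is witnessed by an explicit matrix that rewards large entries in the third row so
strongly that this outweighs the order used in the second row (\<open>leads_block_weight\<close>).\<close>

section \<open>Substitution, coefficients and weights of polynomials\<close>

lemma lookup_scale: "Poly_Mapping.lookup (scale c p) m = c * Poly_Mapping.lookup p m"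
  by (simp add: scale_def Const_def Poly_Mapping.map.rep_eq when_def flip: mult_map_scale_conv_mult)

lemma scale_single: "scale c (Poly_Mapping.single m d) = Poly_Mapping.single m (c * d)"
  by (simp add: scale_def Const_def mult_single)

lemma scale_mult_left: "scale c p * q = scale c (p * q)"
  and scale_mult_right: "p * scale c q = scale c (p * q)"
  by (simp_all add: scale_def algebra_simps)

lemma scale_minus_one: "scale (- 1) p = - p"
  by (rule poly_mapping_eqI) (simp add: lookup_scale)

lemma sum_monomials:
  "(\<Sum>m\<in>Poly_Mapping.keys p. scale (Poly_Mapping.lookup p m) (Poly_Mapping.single m 1)) = p"
  for p :: "('v, 'k::field) mpoly"
proof (rule poly_mapping_eqI)
  fix m
  have "Poly_Mapping.lookup (\<Sum>m\<in>Poly_Mapping.keys p. scale (Poly_Mapping.lookup p m) (Poly_Mapping.single m 1)) m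
      = (\<Sum>k\<in>Poly_Mapping.keys p. if k = m then Poly_Mapping.lookup p k else 0)"
    unfolding lookup_sum
    by (intro sum.cong refl) (auto simp: scale_single lookup_single when_def)
  also have "\<dots> = Poly_Mapping.lookup p m"
    by (auto simp: in_keys_iff)
  finally show "Poly_Mapping.lookup (\<Sum>m\<in>Poly_Mapping.keys p. scale (Poly_Mapping.lookup p m) (Poly_Mapping.single m 1)) m
      = Poly_Mapping.lookup p m" .
qed

lemma mpoly_linear_induct [case_names zero add monomial]:
  fixes p :: "('v, 'k::field) mpoly"
  assumes "P 0" "\<And>p q. P p \<Longrightarrow> P q \<Longrightarrow> P (p + q)"
    "\<And>c m. P (scale c (Poly_Mapping.single m 1))"
  shows "P p"
proof -
  have "P (\<Sum>m\<in>S. scale (Poly_Mapping.lookup p m) (Poly_Mapping.single m 1))" if "finite S" for S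
    using that by (induction S rule: finite_induct) (auto intro: assms)
  from this[of "Poly_Mapping.keys p"] show ?thesis by (simp add: sum_monomials)
qed

text \<open>The index set is kept so that coefficients can be compared exponent by exponent.\<close>

lemma span_image_explicit:
  assumes "f \<in> mpoly.span (g ` A)"
  obtains S c where "finite S" "S \<subseteq> A" "f = (\<Sum>i\<in>S. scale (c i) (g i))"
proof -
  from assms obtain T r where T: "finite T" "T \<subseteq> g ` A" "f = (\<Sum>x\<in>T. scale (r x) x)"
    unfolding mpoly.span_explicit by blast
  from T(2) obtain S where S: "S \<subseteq> A" "inj_on g S" "T = g ` S"
    unfolding subset_image_inj by blast
  from T(1) S(2) have fin: "finite S" unfolding S(3) by (rule finite_imageD)
  have "f = (\<Sum>i\<in>S. scale (r (g i)) (g i))"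
    unfolding T(3) S(3) by (simp add: sum.reindex[OF S(2)])
  then show ?thesis by (rule that[OF fin S(1)])
qed

lemma exponent_induct [consumes 1, case_names zero add single]:
  fixes m :: "'v \<Rightarrow>\<^sub>0 nat"
  assumes "Poly_Mapping.keys m \<subseteq> V" "P 0" "\<And>m m'. P m \<Longrightarrow> P m' \<Longrightarrow> P (m + m')"
    "\<And>v. v \<in> V \<Longrightarrow> P (Poly_Mapping.single v 1)"
  shows "P m"
proof -
  have single: "P (Poly_Mapping.single v k)" if "v \<in> V" for v k
  proof (induction k)
    case (Suc k)
    have "P (Poly_Mapping.single v k + Poly_Mapping.single v 1)"
      by (rule assms(3)[OF Suc assms(4)[OF that]])
    then show ?case by (simp flip: single_add)
  qed (simp add: assms)
  have "P (\<Sum>v\<in>S. Poly_Mapping.single v (Poly_Mapping.lookup m v))" if "finite S" "S \<subseteq> V" for S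
    using that by (induction S rule: finite_induct) (auto intro: assms single)
  moreover have "(\<Sum>v\<in>Poly_Mapping.keys m. Poly_Mapping.single v (Poly_Mapping.lookup m v)) = m"
    by (rule poly_mapping_eqI)
      (auto simp: lookup_sum lookup_single when_def in_keys_iff sum.delta')
  ultimately show ?thesis using assms(1) by (metis finite_keys)
qed

definition mon_eval :: "('v \<Rightarrow> ('u, 'k::field) mpoly) \<Rightarrow> ('v \<Rightarrow>\<^sub>0 nat) \<Rightarrow> ('u, 'k) mpoly" where
  "mon_eval \<phi> m = (\<Prod>v\<in>Poly_Mapping.keys m. \<phi> v ^ Poly_Mapping.lookup m v)"

lemma mon_eval_superset:
  assumes "finite S" "Poly_Mapping.keys m \<subseteq> S"
  shows "mon_eval \<phi> m = (\<Prod>v\<in>S. \<phi> v ^ Poly_Mapping.lookup m v)"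
  unfolding mon_eval_def using assms
  by (intro prod.mono_neutral_left) (auto simp: in_keys_iff)

lemma mon_eval_add: "mon_eval \<phi> (m + m') = mon_eval \<phi> m * mon_eval \<phi> m'"
proof -
  let ?S = "Poly_Mapping.keys m \<union> Poly_Mapping.keys m'"
  have "mon_eval \<phi> (m + m') = (\<Prod>v\<in>?S. \<phi> v ^ Poly_Mapping.lookup (m + m') v)"
    by (rule mon_eval_superset) (auto dest: set_mp[OF keys_add])
  also have "\<dots> = (\<Prod>v\<in>?S. \<phi> v ^ Poly_Mapping.lookup m v) * (\<Prod>v\<in>?S. \<phi> v ^ Poly_Mapping.lookup m' v)"
    by (simp add: lookup_add power_add prod.distrib)
  also have "\<dots> = mon_eval \<phi> m * mon_eval \<phi> m'"
    by (simp flip: mon_eval_superset)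
  finally show ?thesis .
qed

lemma subst_superset:
  assumes "finite S" "Poly_Mapping.keys p \<subseteq> S"
  shows "subst \<phi> p = (\<Sum>m\<in>S. scale (Poly_Mapping.lookup p m) (mon_eval \<phi> m))"
  unfolding subst_def mon_eval_def[symmetric] scale_def using assms
  by (intro sum.mono_neutral_left) (auto simp: in_keys_iff Const_def)

lemma subst_add: "subst \<phi> (p + q) = subst \<phi> p + subst \<phi> q"
proof -
  let ?S = "Poly_Mapping.keys p \<union> Poly_Mapping.keys q"
  have "subst \<phi> (p + q) = (\<Sum>m\<in>?S. scale (Poly_Mapping.lookup (p + q) m) (mon_eval \<phi> m))"
    by (rule subst_superset) (auto dest: set_mp[OF keys_add])
  then show ?thesis
    by (simp add: subst_superset[of ?S] lookup_add mpoly.scale_left_distrib sum.distrib)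
qed

lemma subst_zero [simp]: "subst \<phi> 0 = 0"
  by (simp add: subst_def)

lemma subst_scale: "subst \<phi> (scale c p) = scale c (subst \<phi> p)"
proof -
  have "Poly_Mapping.keys (scale c p) \<subseteq> Poly_Mapping.keys p"
    by (auto simp: in_keys_iff lookup_scale)
  then show ?thesis
    by (simp add: subst_superset[of "Poly_Mapping.keys p"] lookup_scale mpoly.scale_sum_right)
qed

lemma subst_monomial: "subst \<phi> (Poly_Mapping.single m 1) = mon_eval \<phi> m"
  by (subst subst_superset[of "{m}"]) auto

lemma subst_one [simp]: "subst \<phi> 1 = 1"
  using subst_monomial[of \<phi> 0] by (simp add: mon_eval_def)

lemma subst_Var [simp]: "subst \<phi> (Var v) = \<phi> v"
  unfolding Var_def subst_monomial by (simp add: mon_eval_def)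

lemma subst_mult: "subst \<phi> (p * q) = subst \<phi> p * subst \<phi> q"
proof (induction p rule: mpoly_linear_induct)
  case (monomial c m)
  show ?case
  proof (induction q rule: mpoly_linear_induct)
    case (monomial d m')
    show ?case
      by (simp add: scale_mult_left scale_mult_right subst_scale mult_single subst_monomial mon_eval_add)
  qed (simp_all add: distrib_left subst_add)
qed (simp_all add: distrib_right subst_add)

lemma subst_uminus: "subst \<phi> (- p) = - subst \<phi> p"
  by (metis subst_scale scale_minus_one)

lemma subst_diff: "subst \<phi> (p - q) = subst \<phi> p - subst \<phi> q"
  by (metis subst_add subst_uminus uminus_add_conv_diff add.commute)

lemma subst_sum: "subst \<phi> (sum f S) = (\<Sum>i\<in>S. subst \<phi> (f i))"
  by (induction S rule: infinite_finite_induct) (simp_all add: subst_add)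

lemma carrier_poly_ring: "carrier (poly_ring V) = {p. vars p \<subseteq> V}"
  by (simp add: poly_ring_def)

lemma in_carrier_iff: "p \<in> carrier (poly_ring V) \<longleftrightarrow> (\<forall>m\<in>Poly_Mapping.keys p. Poly_Mapping.keys m \<subseteq> V)"
  by (auto simp: carrier_poly_ring vars_def)

lemma carrier_add: "p \<in> carrier (poly_ring V) \<Longrightarrow> q \<in> carrier (poly_ring V) \<Longrightarrow> p + q \<in> carrier (poly_ring V)"
  unfolding in_carrier_iff using keys_add[of p q] by blast

lemma carrier_mult: "p \<in> carrier (poly_ring V) \<Longrightarrow> q \<in> carrier (poly_ring V) \<Longrightarrow> p * q \<in> carrier (poly_ring V)"
  unfolding in_carrier_iff
proof
  fix m assume p: "\<forall>m\<in>Poly_Mapping.keys p. Poly_Mapping.keys m \<subseteq> V"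
    and q: "\<forall>m\<in>Poly_Mapping.keys q. Poly_Mapping.keys m \<subseteq> V"
    and "m \<in> Poly_Mapping.keys (p * q)"
  with keys_mult[of p q] obtain a b where "m = a + b" "a \<in> Poly_Mapping.keys p" "b \<in> Poly_Mapping.keys q"
    by auto
  with p q keys_add[of a b] show "Poly_Mapping.keys m \<subseteq> V" by blast
qed

lemma carrier_Const: "Const c \<in> carrier (poly_ring V)"
  unfolding in_carrier_iff Const_def by simp

lemma carrier_zero: "0 \<in> carrier (poly_ring V)"
  and carrier_one: "1 \<in> carrier (poly_ring V)"
  unfolding in_carrier_iff by simp_all

lemma carrier_scale: "p \<in> carrier (poly_ring V) \<Longrightarrow> scale c p \<in> carrier (poly_ring V)"
  unfolding scale_def by (intro carrier_mult carrier_Const)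

lemma carrier_uminus: "p \<in> carrier (poly_ring V) \<Longrightarrow> - p \<in> carrier (poly_ring V)"
  by (metis carrier_scale scale_minus_one)

lemma carrier_diff: "p \<in> carrier (poly_ring V) \<Longrightarrow> q \<in> carrier (poly_ring V) \<Longrightarrow> p - q \<in> carrier (poly_ring V)"
  using carrier_add[of p V "- q"] carrier_uminus[of q V] by simp

lemma carrier_Var: "v \<in> V \<Longrightarrow> Var v \<in> carrier (poly_ring V)"
  unfolding in_carrier_iff Var_def by simp

lemma poly_ring_simps:
  "monoid.mult (poly_ring V) = (*)" "one (poly_ring V) = 1"
  "ring.zero (poly_ring V) = 0" "add (poly_ring V) = (+)"
  by (simp_all add: poly_ring_def)

lemma cring_poly_ring: "cring (poly_ring V)"
proof (intro cringI abelian_groupI comm_monoidI)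
  fix p assume "p \<in> carrier (poly_ring V)"
  then show "\<exists>q\<in>carrier (poly_ring V). q \<oplus>\<^bsub>poly_ring V\<^esub> p = \<zero>\<^bsub>poly_ring V\<^esub>"
    by (intro bexI[of _ "- p"]) (simp_all add: poly_ring_simps carrier_uminus)
qed (simp_all add: poly_ring_simps carrier_add carrier_mult carrier_zero carrier_one algebra_simps)

lemma mon_weight_superset:
  assumes "finite S" "Poly_Mapping.keys m \<subseteq> S"
  shows "mon_weight w m = (\<Sum>v\<in>S. w v * real (Poly_Mapping.lookup m v))"
  unfolding mon_weight_def using assms
  by (intro sum.mono_neutral_left) (auto simp: in_keys_iff)

lemma mon_weight_add: "mon_weight w (m + m') = mon_weight w m + mon_weight w m'"
proof -
  let ?S = "Poly_Mapping.keys m \<union> Poly_Mapping.keys m'"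
  have "mon_weight w (m + m') = (\<Sum>v\<in>?S. w v * real (Poly_Mapping.lookup (m + m') v))"
    by (rule mon_weight_superset) (auto dest: set_mp[OF keys_add])
  then show ?thesis
    by (simp add: mon_weight_superset[of ?S] lookup_add algebra_simps sum.distrib)
qed

lemma mon_weight_zero [simp]: "mon_weight w 0 = 0"
  by (simp add: mon_weight_def)

lemma mon_weight_single: "mon_weight w (Poly_Mapping.single v k) = w v * real k"
  by (simp add: mon_weight_def)

lemma lookup_init_form:
  "Poly_Mapping.lookup (init_form w p) m =
     (if \<forall>m'\<in>Poly_Mapping.keys p. mon_weight w m \<le> mon_weight w m' then Poly_Mapping.lookup p m else 0)"
proof -
  let ?S = "{m \<in> Poly_Mapping.keys p. \<forall>m'\<in>Poly_Mapping.keys p. mon_weight w m \<le> mon_weight w m'}"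
  have "Poly_Mapping.lookup (init_form w p) m = (\<Sum>k\<in>?S. if k = m then Poly_Mapping.lookup p k else 0)"
    unfolding init_form_def lookup_sum by (intro sum.cong refl) (auto simp: lookup_single when_def)
  then show ?thesis by (auto simp: in_keys_iff)
qed

lemma init_form_scale: "init_form w (scale \<sigma> p) = scale \<sigma> (init_form w p)"
proof (cases "\<sigma> = 0")
  case False
  then have "Poly_Mapping.keys (scale \<sigma> p) = Poly_Mapping.keys p"
    by (auto simp: in_keys_iff lookup_scale)
  then show ?thesis
    by (intro poly_mapping_eqI) (simp add: lookup_init_form lookup_scale)
qed (simp add: init_form_def)

lemma init_form_uminus: "init_form w (- p) = - init_form w p"
  by (metis init_form_scale scale_minus_one)

section \<open>Leading exponents\<close>

definition terms_above :: "('v \<Rightarrow> real) \<Rightarrow> real \<Rightarrow> ('v, 'k::field) mpoly \<Rightarrow> bool" where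
  "terms_above w t p \<longleftrightarrow> (\<forall>m\<in>Poly_Mapping.keys p. t < mon_weight w m)"

text \<open>The initial form of \<open>p\<close> is the monomial with exponent \<open>e\<close> and coefficient 1.  In this
form the notion is visibly multiplicative, and no minimum over the exponents of \<open>p\<close> has to be handled.\<close>

definition leads :: "('v \<Rightarrow> real) \<Rightarrow> ('v, 'k::field) mpoly \<Rightarrow> ('v \<Rightarrow>\<^sub>0 nat) \<Rightarrow> bool" where
  "leads w p e \<longleftrightarrow> terms_above w (mon_weight w e) (p - Poly_Mapping.single e 1)"

lemma terms_above_add: "terms_above w t p \<Longrightarrow> terms_above w t q \<Longrightarrow> terms_above w t (p + q)"
  unfolding terms_above_def using keys_add[of p q] by blast

lemma terms_above_uminus: "terms_above w t p \<Longrightarrow> terms_above w t (- p)"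
  unfolding terms_above_def by (simp add: in_keys_iff)

lemma terms_above_diff: "terms_above w t p \<Longrightarrow> terms_above w t q \<Longrightarrow> terms_above w t (p - q)"
  using terms_above_add[of w t p "- q"] terms_above_uminus[of w t q] by simp

lemma terms_above_mult:
  assumes "\<forall>m\<in>Poly_Mapping.keys p. s \<le> mon_weight w m" "terms_above w t q"
  shows "terms_above w (s + t) (p * q)"
  unfolding terms_above_def
proof
  fix m assume "m \<in> Poly_Mapping.keys (p * q)"
  with keys_mult[of p q] obtain a b where "m = a + b" "a \<in> Poly_Mapping.keys p" "b \<in> Poly_Mapping.keys q"
    by auto
  with assms show "s + t < mon_weight w m"
    by (auto simp: mon_weight_add terms_above_def intro: add_le_less_mono)
qed

lemma leads_lookup:
  assumes "leads w p e" "mon_weight w m \<le> mon_weight w e"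
  shows "Poly_Mapping.lookup p m = (if m = e then 1 else 0)"
proof -
  have "m \<notin> Poly_Mapping.keys (p - Poly_Mapping.single e 1)"
    using assms by (auto simp: leads_def terms_above_def)
  then have "Poly_Mapping.lookup (p - Poly_Mapping.single e 1) m = 0"
    by (simp add: in_keys_iff)
  then show ?thesis by (auto simp: lookup_minus lookup_single when_def)
qed

lemma leads_keys:
  assumes "leads w p e" "m \<in> Poly_Mapping.keys p"
  shows "mon_weight w e \<le> mon_weight w m"
proof (rule ccontr)
  assume "\<not> ?thesis"
  then show False
    using leads_lookup[OF assms(1), of m] assms(2) by (auto simp: in_keys_iff split: if_splits)
qed

lemma leads_mult:
  assumes p: "leads w p e" and q: "leads w q f"
  shows "leads w (p * q) (e + f)"
proof -
  let ?q = "q - Poly_Mapping.single f 1" and ?p = "p - Poly_Mapping.single e 1"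
  \<comment> \<open>Each summand is a product in which one factor has lost its leading term.\<close>
  have "p * q - Poly_Mapping.single (e + f) 1
      = p * ?q + Poly_Mapping.single f 1 * ?p"
    by (simp add: algebra_simps mult_single)
  moreover have "terms_above w (mon_weight w e + mon_weight w f) (p * ?q)"
    using leads_keys[OF p] q by (intro terms_above_mult) (auto simp: leads_def)
  moreover have "terms_above w (mon_weight w f + mon_weight w e) (Poly_Mapping.single f 1 * ?p)"
    using p by (intro terms_above_mult) (auto simp: leads_def)
  ultimately show ?thesis
    by (simp add: leads_def mon_weight_add terms_above_add add.commute)
qed

lemma leads_one: "leads w 1 0"
  by (simp add: leads_def terms_above_def)

lemma leads_of_init_form:
  assumes "init_form w p = Poly_Mapping.single e 1"
  shows "leads w p e"
  unfolding leads_def terms_above_def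
proof
  fix m assume "m \<in> Poly_Mapping.keys (p - Poly_Mapping.single e 1)"
  then have ne: "Poly_Mapping.lookup p m \<noteq> Poly_Mapping.lookup (init_form w p) m"
    by (auto simp: assms in_keys_iff lookup_minus)
  have "Poly_Mapping.lookup (init_form w p) e = 1" using assms by simp
  then have e: "\<forall>m'\<in>Poly_Mapping.keys p. mon_weight w e \<le> mon_weight w m'"
    unfolding lookup_init_form by (auto split: if_splits)
  from ne obtain m' where "m' \<in> Poly_Mapping.keys p" "mon_weight w m' < mon_weight w m"
    by (auto simp: lookup_init_form not_le split: if_splits)
  with e show "mon_weight w e < mon_weight w m" by force
qed

lemma init_form_of_leads:
  assumes "leads w p e"
  shows "init_form w p = Poly_Mapping.single e 1"
proof (rule poly_mapping_eqI)
  fix m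
  have "e \<in> Poly_Mapping.keys p"
    using leads_lookup[OF assms, of e] by (simp add: in_keys_iff)
  then show "Poly_Mapping.lookup (init_form w p) m = Poly_Mapping.lookup (Poly_Mapping.single e 1) m"
    using leads_lookup[OF assms, of m] leads_keys[OF assms]
    by (auto simp: lookup_init_form lookup_single when_def)
qed

lemma leads_scale_above:
  assumes "leads w h e" "\<sigma> \<noteq> 0" "terms_above w t (scale \<sigma> h)"
  shows "t < mon_weight w e"
  using assms leads_lookup[OF assms(1), of e] by (simp add: terms_above_def in_keys_iff lookup_scale)

text \<open>If the two leading exponents differ, the lighter one cannot cancel: in the other summand it
could only occur as an exponent that is heavier than that summand's leading one.  So a lower bound for the
exponents of the sum bounds both leading exponents.\<close>

lemma leads_scale_sum_above:
  assumes h1: "leads w h1 e1" "\<sigma>1 \<noteq> 0" and h2: "leads w h2 e2" "\<sigma>2 \<noteq> 0"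
    and ne: "e1 \<noteq> e2" and ab: "terms_above w t (scale \<sigma>1 h1 + scale \<sigma>2 h2)"
  shows "t < mon_weight w e1 \<and> t < mon_weight w e2"
proof -
  have lk: "Poly_Mapping.lookup (scale \<sigma>1 h1 + scale \<sigma>2 h2) m
      = \<sigma>1 * Poly_Mapping.lookup h1 m + \<sigma>2 * Poly_Mapping.lookup h2 m" for m
    by (simp add: lookup_add lookup_scale)
  show ?thesis
  proof (cases "mon_weight w e1 \<le> mon_weight w e2")
    case True
    then have "Poly_Mapping.lookup (scale \<sigma>1 h1 + scale \<sigma>2 h2) e1 = \<sigma>1"
      using ne leads_lookup[OF h1(1), of e1] leads_lookup[OF h2(1), of e1] by (simp add: lk)
    with h1(2) have "e1 \<in> Poly_Mapping.keys (scale \<sigma>1 h1 + scale \<sigma>2 h2)"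
      by (simp add: in_keys_iff)
    with ab have "t < mon_weight w e1" by (simp only: terms_above_def)
    then show ?thesis using True by simp
  next
    case False
    then have "Poly_Mapping.lookup (scale \<sigma>1 h1 + scale \<sigma>2 h2) e2 = \<sigma>2"
      using ne leads_lookup[OF h1(1), of e2] leads_lookup[OF h2(1), of e2] by (simp add: lk)
    with h2(2) have "e2 \<in> Poly_Mapping.keys (scale \<sigma>1 h1 + scale \<sigma>2 h2)"
      by (simp add: in_keys_iff)
    with ab have "t < mon_weight w e2" by (simp only: terms_above_def)
    then show ?thesis using False by simp
  qed
qed

section \<open>Collections of columns and row swaps\<close>

type_synonym column = "nat \<times> nat \<times> nat"

text \<open>The strict total order \<open>a + 1, a + 2, \<dots>, 1, 2, \<dots>, a\<close>.\<close>

definition precedes :: "nat \<Rightarrow> nat \<Rightarrow> nat \<Rightarrow> bool" where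
  "precedes a x y \<longleftrightarrow> (if x \<le> a then x < y \<and> y \<le> a else x < y \<or> y \<le> a)"

lemma precedes_total: "x \<noteq> y \<Longrightarrow> precedes a x y \<or> precedes a y x"
  by (auto simp: precedes_def)

text \<open>The columns of the matching field with first block \<open>{1..a}\<close>.  If \<open>p \<le> a\<close>, then also \<open>q \<le> a\<close>;
a column with both entries in the second block and third entry in the first is excluded by
\<open>p < r\<close>.\<close>

definition columns :: "nat \<Rightarrow> nat \<Rightarrow> column set" where
  "columns a n = {(p, q, r). {p, q, r} \<subseteq> {1..n} \<and> precedes a p q \<and> p < r \<and> q < r}"

lemma finite_columns: "finite (columns a n)"
  by (rule finite_subset[of _ "{1..n} \<times> {1..n} \<times> {1..n}"]) (auto simp: columns_def)

definition rows :: "column multiset \<Rightarrow> nat multiset \<times> nat multiset \<times> nat multiset" where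
  "rows X = (image_mset fst X, image_mset (fst \<circ> snd) X, image_mset (snd \<circ> snd) X)"

text \<open>The equivalence relation on collections of columns generated by exchanging, within one row,
the entries of two columns, where all four columns involved have to be valid.\<close>

inductive swap_connected :: "nat \<Rightarrow> nat \<Rightarrow> column multiset \<Rightarrow> column multiset \<Rightarrow> bool" for a n where
  swap_row1: "{(p, q, r), (s, t, u), (s, q, r), (p, t, u)} \<subseteq> columns a n \<Longrightarrow>
    swap_connected a n {#(p, q, r), (s, t, u)#} {#(s, q, r), (p, t, u)#}"
| swap_row2: "{(p, q, r), (s, t, u), (p, t, r), (s, q, u)} \<subseteq> columns a n \<Longrightarrow>
    swap_connected a n {#(p, q, r), (s, t, u)#} {#(p, t, r), (s, q, u)#}"
| swap_row3: "{(p, q, r), (s, t, u), (p, q, u), (s, t, r)} \<subseteq> columns a n \<Longrightarrow>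
    swap_connected a n {#(p, q, r), (s, t, u)#} {#(p, q, u), (s, t, r)#}"
| refl: "set_mset X \<subseteq> columns a n \<Longrightarrow> swap_connected a n X X"
| sym: "swap_connected a n X Y \<Longrightarrow> swap_connected a n Y X"
| trans: "swap_connected a n X Y \<Longrightarrow> swap_connected a n Y Z \<Longrightarrow> swap_connected a n X Z"
| add: "c \<in> columns a n \<Longrightarrow> swap_connected a n X Y \<Longrightarrow> swap_connected a n (add_mset c X) (add_mset c Y)"

lemma swap_connected_columns:
  "swap_connected a n X Y \<Longrightarrow> set_mset X \<subseteq> columns a n \<and> set_mset Y \<subseteq> columns a n"
  by (induction rule: swap_connected.induct) auto

lemma swap_connected_union:
  assumes "swap_connected a n X Y" "set_mset Z \<subseteq> columns a n"
  shows "swap_connected a n (Z + X) (Z + Y)"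
  using assms(2) by (induction Z) (simp_all add: assms(1) swap_connected.add)

lemma swap_connected_rows: "swap_connected a n X Y \<Longrightarrow> rows X = rows Y"
  by (induction rule: swap_connected.induct) (auto simp: rows_def)

definition row_set1 :: "column multiset \<Rightarrow> nat set" where
  "row_set1 X = fst ` set_mset X"

definition row_set2 :: "column multiset \<Rightarrow> nat set" where
  "row_set2 X = (fst \<circ> snd) ` set_mset X"

definition row_set3 :: "column multiset \<Rightarrow> nat set" where
  "row_set3 X = (snd \<circ> snd) ` set_mset X"

lemma finite_row_sets [simp]: "finite (row_set1 X)" "finite (row_set2 X)" "finite (row_set3 X)"
  by (simp_all add: row_set1_def row_set2_def row_set3_def)

lemma row_sets_cong:
  assumes "rows X = rows Y"
  shows "row_set1 X = row_set1 Y" "row_set2 X = row_set2 Y" "row_set3 X = row_set3 Y"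
proof -
  from assms have "set_mset (image_mset fst X) = set_mset (image_mset fst Y)"
    "set_mset (image_mset (fst \<circ> snd) X) = set_mset (image_mset (fst \<circ> snd) Y)"
    "set_mset (image_mset (snd \<circ> snd) X) = set_mset (image_mset (snd \<circ> snd) Y)"
    by (simp_all add: rows_def)
  then show "row_set1 X = row_set1 Y" "row_set2 X = row_set2 Y" "row_set3 X = row_set3 Y"
    by (simp_all add: row_set1_def row_set2_def row_set3_def)
qed

lemma row_sets_member:
  assumes "(p, q, r) \<in># X"
  shows "p \<in> row_set1 X" "q \<in> row_set2 X" "r \<in> row_set3 X"
  using assms image_eqI[of p fst "(p, q, r)"] image_eqI[of q "fst \<circ> snd" "(p, q, r)"]
    image_eqI[of r "snd \<circ> snd" "(p, q, r)"]
  by (simp_all add: row_set1_def row_set2_def row_set3_def)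

lemma swap_connected_row_sets:
  assumes "swap_connected a n X (add_mset c Z)" "(p, q, r) \<in># Z"
  shows "p \<in> row_set1 X" "q \<in> row_set2 X" "r \<in> row_set3 X"
    "(p, q, r) \<in> columns a n"
  unfolding row_sets_cong[OF swap_connected_rows[OF assms(1)]]
  using swap_connected_columns[OF assms(1)] assms(2)
  by (auto intro!: row_sets_member)

lemma swap_connected_self:
  assumes "set_mset X \<subseteq> columns a n" "c \<in># X"
  shows "swap_connected a n X (add_mset c (X - {#c#}))"
  using assms by (simp add: swap_connected.refl)

text \<open>One step of rebuilding a collection around a distinguished column: its first entry can be
replaced by any entry \<open>p'\<close> of the first row, if the swap is valid against each column that could hold
\<open>p'\<close>.  The next two lemmas do the same for the other rows.\<close>

lemma reach_swap1:
  assumes X: "swap_connected a n X (add_mset (p, q, r) Z)" and p': "p' \<in> row_set1 X"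
    and swap: "\<And>t u. (p', t, u) \<in># Z \<Longrightarrow> (p', q, r) \<in> columns a n \<and> (p, t, u) \<in> columns a n"
  shows "\<exists>Z. swap_connected a n X (add_mset (p', q, r) Z)"
proof (cases "p' = p")
  case False
  have "p' \<in> row_set1 (add_mset (p, q, r) Z)"
    using p' row_sets_cong(1)[OF swap_connected_rows[OF X]] by simp
  with False obtain t u where tu: "(p', t, u) \<in># Z" by (auto simp: row_set1_def)
  then obtain Z' where Z: "Z = add_mset (p', t, u) Z'" by (metis multi_member_split)
  have "swap_connected a n {#(p, q, r), (p', t, u)#} {#(p', q, r), (p, t, u)#}"
    using swap[OF tu] swap_connected_columns[OF X] Z by (intro swap_connected.swap_row1) auto
  then have "swap_connected a n (Z' + {#(p, q, r), (p', t, u)#}) (Z' + {#(p', q, r), (p, t, u)#})"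
    using swap_connected_columns[OF X] Z by (intro swap_connected_union) auto
  with swap_connected.trans[OF X] Z show ?thesis
    by (intro exI[of _ "add_mset (p, t, u) Z'"]) (simp add: add_mset_commute)
qed (use X in auto)

lemma reach_swap2:
  assumes X: "swap_connected a n X (add_mset (p, q, r) Z)" and q': "q' \<in> row_set2 X"
    and swap: "\<And>s u. (s, q', u) \<in># Z \<Longrightarrow> (p, q', r) \<in> columns a n \<and> (s, q, u) \<in> columns a n"
  shows "\<exists>Z. swap_connected a n X (add_mset (p, q', r) Z)"
proof (cases "q' = q")
  case False
  have "q' \<in> row_set2 (add_mset (p, q, r) Z)"
    using q' row_sets_cong(2)[OF swap_connected_rows[OF X]] by simp
  with False obtain s u where su: "(s, q', u) \<in># Z" by (auto simp: row_set2_def)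
  then obtain Z' where Z: "Z = add_mset (s, q', u) Z'" by (metis multi_member_split)
  have "swap_connected a n {#(p, q, r), (s, q', u)#} {#(p, q', r), (s, q, u)#}"
    using swap[OF su] swap_connected_columns[OF X] Z by (intro swap_connected.swap_row2) auto
  then have "swap_connected a n (Z' + {#(p, q, r), (s, q', u)#}) (Z' + {#(p, q', r), (s, q, u)#})"
    using swap_connected_columns[OF X] Z by (intro swap_connected_union) auto
  with swap_connected.trans[OF X] Z show ?thesis
    by (intro exI[of _ "add_mset (s, q, u) Z'"]) (simp add: add_mset_commute)
qed (use X in auto)

lemma reach_swap3:
  assumes X: "swap_connected a n X (add_mset (p, q, r) Z)" and r': "r' \<in> row_set3 X"
    and swap: "\<And>s t. (s, t, r') \<in># Z \<Longrightarrow> (p, q, r') \<in> columns a n \<and> (s, t, r) \<in> columns a n"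
  shows "\<exists>Z. swap_connected a n X (add_mset (p, q, r') Z)"
proof (cases "r' = r")
  case False
  have "r' \<in> row_set3 (add_mset (p, q, r) Z)"
    using r' row_sets_cong(3)[OF swap_connected_rows[OF X]] by simp
  with False obtain s t where st: "(s, t, r') \<in># Z" by (auto simp: row_set3_def)
  then obtain Z' where Z: "Z = add_mset (s, t, r') Z'" by (metis multi_member_split)
  have "swap_connected a n {#(p, q, r), (s, t, r')#} {#(p, q, r'), (s, t, r)#}"
    using swap[OF st] swap_connected_columns[OF X] Z by (intro swap_connected.swap_row3) auto
  then have "swap_connected a n (Z' + {#(p, q, r), (s, t, r')#}) (Z' + {#(p, q, r'), (s, t, r)#})"
    using swap_connected_columns[OF X] Z by (intro swap_connected_union) auto
  with swap_connected.trans[OF X] Z show ?thesis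
    by (intro exI[of _ "add_mset (s, t, r) Z'"]) (simp add: add_mset_commute)
qed (use X in auto)

text \<open>A column that can be produced by swaps from any collection whose rows have the given entries.
It depends on the row contents only, which is what allows two collections to be compared.  Wherever
two columns could compete for an entry, the extremal one is chosen, so that the columns receiving the
displaced entries remain valid.\<close>

definition common_column :: "nat \<Rightarrow> nat set \<Rightarrow> nat set \<Rightarrow> nat set \<Rightarrow> column" where
  "common_column a R1 R2 R3 =
     (if R1 \<inter> {..a} \<noteq> {} then
        (let p = Min (R1 \<inter> {..a}) in (p, Min {q \<in> R2. p < q \<and> q \<le> a}, Min R3))
      else if R2 \<inter> {a<..} \<noteq> {} then
        (let q = Min (R2 \<inter> {a<..}) in (Max {p \<in> R1. p < q}, q, Min {r \<in> R3. q < r}))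
      else (let p = Min R1 in (p, Min R2, Min {r \<in> R3. p < r})))"

text \<open>Some column has its first, hence also its second entry in the first block.  The smallest such first
entry \<open>p\<close> and the smallest third entry \<open>r\<close> are brought together first.  If a column of \<open>p\<close> has its
second entry below \<open>r\<close>, third entries are swapped; otherwise \<open>r\<close> lies in the first block, so
the column of \<open>r\<close> lies there entirely, and below the second entry of the column of \<open>p\<close>, so that first
entries can be swapped.  Then the smallest second entry that fits above \<open>p\<close> is swapped in; the column
it comes from receives a larger one.\<close>

lemma reach_common_column_first_row_low:
  assumes X: "set_mset X \<subseteq> columns a n" and ne: "row_set1 X \<inter> {..a} \<noteq> {}"
  shows "\<exists>Z. swap_connected a n X (add_mset (common_column a (row_set1 X) (row_set2 X) (row_set3 X)) Z)"
proof -
  define p where "p = Min (row_set1 X \<inter> {..a})"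
  define r where "r = Min (row_set3 X)"
  define q where "q = Min {q \<in> row_set2 X. p < q \<and> q \<le> a}"
  have p: "p \<in> row_set1 X" "p \<le> a" and p_min: "\<And>x. x \<in> row_set1 X \<Longrightarrow> x \<le> a \<Longrightarrow> p \<le> x"
    using Min_in[OF _ ne] by (auto simp: p_def)
  then obtain q' r' where pqr': "(p, q', r') \<in># X" by (auto simp: row_set1_def)
  then have "row_set3 X \<noteq> {}" by (auto simp: row_set3_def)
  then have r: "r \<in> row_set3 X" and r_min: "\<And>x. x \<in> row_set3 X \<Longrightarrow> r \<le> x"
    using Min_in by (auto simp: r_def)
  then obtain s t where str: "(s, t, r) \<in># X" by (auto simp: row_set3_def)
  have q'_mem: "q' \<in> {q \<in> row_set2 X. p < q \<and> q \<le> a}"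
    using pqr' X p by (force simp: row_set2_def columns_def precedes_def)
  then have "q \<in> {q \<in> row_set2 X. p < q \<and> q \<le> a}" unfolding q_def by (intro Min_in) auto
  then have q: "q \<in> row_set2 X" "p < q" "q \<le> a" by auto
  have q_min: "q \<le> x" if "x \<in> row_set2 X" "p < x" "x \<le> a" for x
    unfolding q_def using that by (intro Min_le) auto
  have "\<exists>x Z. swap_connected a n X (add_mset (p, x, r) Z)"
  proof (cases "\<exists>x y. (p, x, y) \<in># X \<and> x < r")
    case True
    then obtain x y where xy: "(p, x, y) \<in># X" "x < r" by blast
    have "\<exists>Z. swap_connected a n X (add_mset (p, x, r) Z)"
    proof (rule reach_swap3[OF swap_connected_self[OF X xy(1)] r])
      fix s' t' assume "(s', t', r) \<in># X - {#(p, x, y)#}"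
      then have "(s', t', r) \<in> columns a n" using X by (auto dest: in_diffD)
      moreover have "r \<le> y" using xy(1) by (intro r_min) (force simp: row_set3_def)
      moreover have "(p, x, y) \<in> columns a n" using X xy by auto
      ultimately show "(p, x, r) \<in> columns a n \<and> (s', t', y) \<in> columns a n"
        using p xy(2) by (auto simp: columns_def precedes_def split: if_splits)
    qed
    then show ?thesis by blast
  next
    case False
    have "\<exists>Z. swap_connected a n X (add_mset (p, t, r) Z)"
    proof (rule reach_swap1[OF swap_connected_self[OF X str] p(1)])
      fix x y assume "(p, x, y) \<in># X - {#(s, t, r)#}"
      then have xy: "(p, x, y) \<in># X" by (auto dest: in_diffD)
      then have "(p, x, y) \<in> columns a n" using X by auto
      moreover have "r \<le> x" using xy False by force
      moreover have str': "(s, t, r) \<in> columns a n" using X str by auto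
      moreover from calculation have "s \<le> a" using p(2) by (auto simp: columns_def precedes_def)
      then have "p \<le> s" using str by (intro p_min) (force simp: row_set1_def)
      ultimately show "(p, t, r) \<in> columns a n \<and> (s, x, y) \<in> columns a n"
        using p by (auto simp: columns_def precedes_def split: if_splits)
    qed
    then show ?thesis by blast
  qed
  then obtain x Z where xZ: "swap_connected a n X (add_mset (p, x, r) Z)" by blast
  then have xcol: "(p, x, r) \<in> columns a n" using swap_connected_columns by force
  have "\<exists>Z. swap_connected a n X (add_mset (p, q, r) Z)"
  proof (rule reach_swap2[OF xZ q(1)])
    fix s u assume su: "(s, q, u) \<in># Z"
    note mem = swap_connected_row_sets[OF xZ su]
    have x: "x \<in> row_set2 X"
      using row_sets_cong(2)[OF swap_connected_rows[OF xZ]] by (auto simp: row_set2_def)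
    have "p < x" "x \<le> a" using xcol p(2) by (auto simp: columns_def precedes_def)
    with x have "q \<le> x" by (rule q_min)
    with mem r_min[OF mem(3)] xcol p q \<open>p < x\<close> \<open>x \<le> a\<close>
    show "(p, q, r) \<in> columns a n \<and> (s, x, u) \<in> columns a n"
      by (auto simp: columns_def precedes_def split: if_splits)
  qed
  then show ?thesis
    using ne by (simp add: common_column_def Let_def p_def q_def r_def)
qed

text \<open>All first entries lie in the second block, and so do all third entries.  A second entry \<open>q\<close> in
the second block requires \<open>p < q < r\<close>.  Taking the smallest \<open>r\<close> and the largest \<open>p\<close> that fit
hands larger third and smaller first entries to the other columns.\<close>

lemma reach_common_column_second_row_high:
  assumes X: "set_mset X \<subseteq> columns a n" and low: "row_set1 X \<inter> {..a} = {}"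
    and ne: "row_set2 X \<inter> {a<..} \<noteq> {}"
  shows "\<exists>Z. swap_connected a n X (add_mset (common_column a (row_set1 X) (row_set2 X) (row_set3 X)) Z)"
proof -
  define q where "q = Min (row_set2 X \<inter> {a<..})"
  define p where "p = Max {p \<in> row_set1 X. p < q}"
  define r where "r = Min {r \<in> row_set3 X. q < r}"
  have q: "q \<in> row_set2 X" "a < q"
    using Min_in[OF _ ne] by (auto simp: q_def)
  then obtain s u where squ: "(s, q, u) \<in># X" by (auto simp: row_set2_def)
  then have squ': "(s, q, u) \<in> columns a n" using X by auto
  have "u \<in> {r \<in> row_set3 X. q < r}"
    using squ squ' by (force simp: row_set3_def columns_def)
  then have "r \<in> {r \<in> row_set3 X. q < r}" unfolding r_def by (intro Min_in) auto
  then have r: "r \<in> row_set3 X" "q < r" by auto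
  have r_min: "r \<le> x" if "x \<in> row_set3 X" "q < x" for x
    unfolding r_def using that by (intro Min_le) auto
  have s: "s \<in> {p \<in> row_set1 X. p < q}"
    using squ squ' q by (force simp: row_set1_def columns_def precedes_def split: if_splits)
  then have "p \<in> {p \<in> row_set1 X. p < q}" unfolding p_def by (intro Max_in) auto
  then have p: "p \<in> row_set1 X" "p < q" by auto
  then have pa: "a < p" using low by (auto simp: disjoint_iff)
  have "s \<le> p" unfolding p_def using s by (intro Max_ge) auto
  have sa: "a < s" using low s by (auto simp: disjoint_iff)
  have "\<exists>Z. swap_connected a n X (add_mset (s, q, r) Z)"
  proof (rule reach_swap3[OF swap_connected_self[OF X squ] r(1)])
    fix s' t' assume "(s', t', r) \<in># X - {#(s, q, u)#}"
    then have "(s', t', r) \<in> columns a n" using X by (auto dest: in_diffD)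
    moreover have "r \<le> u"
      using \<open>u \<in> {r \<in> row_set3 X. q < r}\<close> by (auto intro: r_min)
    ultimately show "(s, q, r) \<in> columns a n \<and> (s', t', u) \<in> columns a n"
      using squ' r s by (auto simp: columns_def)
  qed
  then obtain Z where Z: "swap_connected a n X (add_mset (s, q, r) Z)" by blast
  then have scol: "(s, q, r) \<in> columns a n" using swap_connected_columns by force
  have "\<exists>Z. swap_connected a n X (add_mset (p, q, r) Z)"
  proof (rule reach_swap1[OF Z p(1)])
    fix t' u' assume tu: "(p, t', u') \<in># Z"
    from swap_connected_row_sets(4)[OF Z tu] scol p pa sa q r \<open>s \<le> p\<close>
    show "(p, q, r) \<in> columns a n \<and> (s, t', u') \<in> columns a n"
      by (auto simp: columns_def precedes_def split: if_splits)
  qed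
  then show ?thesis
    using ne low by (simp add: common_column_def Let_def p_def q_def r_def)
qed

text \<open>First and third entries all lie in the second block and second entries in the first, so only
\<open>p < r\<close> restricts the columns and second entries can be permuted freely.\<close>

lemma reach_common_column_split:
  assumes X: "set_mset X \<subseteq> columns a n" and low: "row_set1 X \<inter> {..a} = {}"
    and high: "row_set2 X \<inter> {a<..} = {}" and ne: "X \<noteq> {#}"
  shows "\<exists>Z. swap_connected a n X (add_mset (common_column a (row_set1 X) (row_set2 X) (row_set3 X)) Z)"
proof -
  define p where "p = Min (row_set1 X)"
  define q where "q = Min (row_set2 X)"
  define r where "r = Min {r \<in> row_set3 X. p < r}"
  have p: "p \<in> row_set1 X" unfolding p_def using ne by (intro Min_in) (auto simp: row_set1_def)
  have q: "q \<in> row_set2 X" unfolding q_def using ne by (intro Min_in) (auto simp: row_set2_def)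
  from p obtain t u where ptu: "(p, t, u) \<in># X" by (auto simp: row_set1_def)
  then have ptu': "(p, t, u) \<in> columns a n" using X by auto
  have u: "u \<in> {r \<in> row_set3 X. p < r}"
    using ptu ptu' by (force simp: row_set3_def columns_def)
  then have "r \<in> {r \<in> row_set3 X. p < r}" unfolding r_def by (intro Min_in) auto
  then have r: "r \<in> row_set3 X" "p < r" by auto
  have "r \<le> u" unfolding r_def using u by (intro Min_le) auto
  have pa: "a < p" and qa: "q \<le> a" using p q low high by (auto simp: disjoint_iff)
  have ta: "t \<le> a" using ptu high by (force simp: disjoint_iff row_set2_def)
  have "\<exists>Z. swap_connected a n X (add_mset (p, q, u) Z)"
  proof (rule reach_swap2[OF swap_connected_self[OF X ptu] q])
    fix s' u' assume "(s', q, u') \<in># X - {#(p, t, u)#}"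
    then have s': "(s', q, u') \<in># X" by (auto dest: in_diffD)
    then have "(s', q, u') \<in> columns a n" using X by auto
    moreover have "a < s'" using s' low by (force simp: disjoint_iff row_set1_def)
    ultimately show "(p, q, u) \<in> columns a n \<and> (s', t, u') \<in> columns a n"
      using ptu' pa qa ta by (auto simp: columns_def precedes_def)
  qed
  then obtain Z where Z: "swap_connected a n X (add_mset (p, q, u) Z)" by blast
  then have col: "(p, q, u) \<in> columns a n" using swap_connected_columns by force
  have "\<exists>Z. swap_connected a n X (add_mset (p, q, r) Z)"
  proof (rule reach_swap3[OF Z r(1)])
    fix s' t' assume st: "(s', t', r) \<in># Z"
    from swap_connected_row_sets(4)[OF Z st] col pa qa r \<open>r \<le> u\<close>
    show "(p, q, r) \<in> columns a n \<and> (s', t', u) \<in> columns a n"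
      by (auto simp: columns_def precedes_def split: if_splits)
  qed
  then show ?thesis
    using high low by (simp add: common_column_def Let_def p_def q_def r_def)
qed

lemma reach_common_column:
  assumes "set_mset X \<subseteq> columns a n" "X \<noteq> {#}"
  shows "\<exists>Z. swap_connected a n X (add_mset (common_column a (row_set1 X) (row_set2 X) (row_set3 X)) Z)"
proof (cases "row_set1 X \<inter> {..a} = {}")
  case True
  then show ?thesis
    using reach_common_column_second_row_high[OF assms(1)] reach_common_column_split[OF assms(1)]
      assms(2) by (cases "row_set2 X \<inter> {a<..} = {}") simp_all
qed (rule reach_common_column_first_row_low[OF assms(1)])

text \<open>Both collections are moved to one containing their common column, which is then removed.\<close>

theorem swap_connected_if_same_rows:
  assumes "set_mset X \<subseteq> columns a n" "set_mset Y \<subseteq> columns a n" "rows X = rows Y"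
  shows "swap_connected a n X Y"
  using assms
proof (induction "size X" arbitrary: X Y)
  case 0
  then show ?case by (auto simp: rows_def intro: swap_connected.refl)
next
  case (Suc k)
  define c where "c = common_column a (row_set1 X) (row_set2 X) (row_set3 X)"
  have "X \<noteq> {#}" "Y \<noteq> {#}" using Suc.hyps Suc.prems by (auto simp: rows_def)
  then obtain X' Y' where X': "swap_connected a n X (add_mset c X')" and Y': "swap_connected a n Y (add_mset c Y')"
    using reach_common_column[OF Suc.prems(1)] reach_common_column[OF Suc.prems(2)]
    unfolding c_def row_sets_cong[OF Suc.prems(3)] by metis
  have XY: "rows (add_mset c X') = rows (add_mset c Y')"
    using swap_connected_rows[OF X'] swap_connected_rows[OF Y'] Suc.prems(3) by simp
  have "swap_connected a n X' Y'"
  proof (rule Suc.hyps(1))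
    have "size X = size (add_mset c X')"
      using swap_connected_rows[OF X'] by (metis rows_def prod.inject size_image_mset)
    then show "k = size X'" using Suc.hyps(2) by simp
    show "rows X' = rows Y'" using XY by (simp add: rows_def)
  qed (use swap_connected_columns[OF X'] swap_connected_columns[OF Y'] in auto)
  then have "swap_connected a n (add_mset c X') (add_mset c Y')"
    using swap_connected_columns[OF X'] by (auto intro: swap_connected.add)
  with X' have "swap_connected a n X (add_mset c Y')" by (rule swap_connected.trans)
  then show ?case using swap_connected.sym[OF Y'] by (rule swap_connected.trans)
qed

section \<open>Column determinants\<close>

text \<open>The columns are taken in the order of the matching field rather than sorted, so that the leading
coefficient is 1 and no signs occur.\<close>

fun col_det :: "column \<Rightarrow> (nat \<times> nat, 'k::field) mpoly" where
  "col_det (p, q, r) =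
     Var (1, p) * (Var (2, q) * Var (3, r) - Var (3, q) * Var (2, r))
   - Var (2, p) * (Var (1, q) * Var (3, r) - Var (3, q) * Var (1, r))
   + Var (3, p) * (Var (1, q) * Var (2, r) - Var (2, q) * Var (1, r))"

lemma col_det_swap12: "col_det (q, p, r) = - col_det (p, q, r)"
  by (simp add: algebra_simps)

lemma col_det_swap23: "col_det (p, r, q) = - col_det (p, q, r)"
  by (simp add: algebra_simps)

lemma col_det_repeated: "col_det (p, p, r) = 0" "col_det (p, r, r) = 0" "col_det (p, r, p) = 0"
  by (simp_all add: algebra_simps)

text \<open>Exchange relations: one entry of the first column is exchanged in turn with each entry of the
second, the other entries staying in place.\<close>

lemma exchange_entry1:
  "col_det (p, q, r) * col_det (s, t, u) - col_det (s, q, r) * col_det (p, t, u)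
   = col_det (t, q, r) * col_det (s, p, u) + col_det (u, q, r) * col_det (s, t, p)"
  by (simp add: algebra_simps)

lemma exchange_entry2:
  "col_det (p, q, r) * col_det (s, t, u) - col_det (p, t, r) * col_det (s, q, u)
   = col_det (p, s, r) * col_det (q, t, u) + col_det (p, u, r) * col_det (s, t, q)"
  by (simp add: algebra_simps)

lemma exchange_entry3:
  "col_det (p, q, r) * col_det (s, t, u) - col_det (p, q, u) * col_det (s, t, r)
   = col_det (p, q, s) * col_det (r, t, u) + col_det (p, q, t) * col_det (s, r, u)"
  by (simp add: algebra_simps)

fun top_entry :: "column \<Rightarrow> nat" where
  "top_entry (p, q, r) = max p (max q r)"

fun entries :: "column \<Rightarrow> nat set" where
  "entries (p, q, r) = {p, q, r}"

text \<open>Up to sign, a nonzero column determinant is that of the valid column formed by its entries.  Of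
the exponent of that column only the entry in the third row matters below: it is the largest one,
whatever the blocks are.\<close>

lemma col_det_cases:
  assumes "entries A \<subseteq> {1..n}"
  obtains "col_det A = (0 :: (nat \<times> nat, 'k::field) mpoly)"
  | u \<sigma> where "u \<in> columns a n" "\<sigma> \<noteq> 0" "col_det A = scale \<sigma> (col_det u :: (nat \<times> nat, 'k) mpoly)"
    "snd (snd u) = top_entry A"
proof -
  have last: "\<exists>u \<sigma>. u \<in> columns a n \<and> \<sigma> \<noteq> 0 \<and>
      col_det (x, y, z) = scale \<sigma> (col_det u :: (nat \<times> nat, 'k) mpoly) \<and> snd (snd u) = z"
    if "{x, y, z} \<subseteq> {1..n}" "x \<noteq> y" "x < z" "y < z" for x y z
    using precedes_total[OF that(2), of a]
  proof
    assume "precedes a x y"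
    with that show ?thesis
      by (intro exI[of _ "(x, y, z)"] exI[of _ 1]) (simp add: columns_def)
  next
    assume "precedes a y x"
    with that show ?thesis
      using col_det_swap12[of x y z]
      by (intro exI[of _ "(y, x, z)"] exI[of _ "- 1"])
        (simp add: columns_def scale_minus_one del: col_det.simps)
  qed
  have neg: "\<exists>u \<sigma>. u \<in> columns a n \<and> \<sigma> \<noteq> 0 \<and>
      f = scale \<sigma> (col_det u :: (nat \<times> nat, 'k) mpoly) \<and> snd (snd u) = z"
    if "\<exists>u \<sigma>. u \<in> columns a n \<and> \<sigma> \<noteq> 0 \<and>
      - f = scale \<sigma> (col_det u :: (nat \<times> nat, 'k) mpoly) \<and> snd (snd u) = z" for f z
  proof -
    from that obtain u \<sigma> where u: "u \<in> columns a n" "\<sigma> \<noteq> 0"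
      "- f = scale \<sigma> (col_det u :: (nat \<times> nat, 'k) mpoly)" "snd (snd u) = z" by blast
    have "f = scale (- \<sigma>) (col_det u)"
      using u(3) by (metis mpoly.scale_minus_left minus_minus)
    with u show ?thesis by (intro exI[of _ u] exI[of _ "- \<sigma>"]) simp
  qed
  obtain x y z where A: "A = (x, y, z)" by (cases A)
  with assms have in_n: "{x, y, z} \<subseteq> {1..n}" by simp
  consider "x = y \<or> y = z \<or> x = z" | "x \<noteq> y" "x < z" "y < z" | "x \<noteq> z" "x < y" "z < y" | "y \<noteq> z" "y < x" "z < x"
    by linarith
  then show ?thesis
  proof cases
    case 1
    then show ?thesis using that(1) by (auto simp: A simp del: col_det.simps simp: col_det_repeated)
  next
    case 2
    then have "top_entry A = z" by (simp add: A)
    with last[OF in_n 2] that(2) show ?thesis unfolding A by metis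
  next
    case 3
    then have "top_entry A = y" by (simp add: A)
    moreover have "- col_det A = (col_det (x, z, y) :: (nat \<times> nat, 'k) mpoly)"
      unfolding A by (rule col_det_swap23[symmetric])
    ultimately show ?thesis using neg[of "col_det A" y] last[of x z y] in_n 3 that(2) by auto
  next
    case 4
    then have "top_entry A = x" by (simp add: A)
    moreover have "- col_det A = (col_det (z, y, x) :: (nat \<times> nat, 'k) mpoly)"
      unfolding A by (simp add: algebra_simps)
    ultimately show ?thesis using neg[of "col_det A" x] last[of z y x] in_n 4 that(2) by auto
  qed
qed

lemma pair_neq:
  fixes x y x' y' :: nat
  assumes "y' \<noteq> x" "y' \<noteq> y"
  shows "{#x, y#} \<noteq> {#x', y'#}"
  using assms by (auto simp: add_eq_conv_ex)

fun col_exp :: "column \<Rightarrow> (nat \<times> nat) \<Rightarrow>\<^sub>0 nat" where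
  "col_exp (p, q, r) = Poly_Mapping.single (1, p) 1 + Poly_Mapping.single (2, q) 1 + Poly_Mapping.single (3, r) 1"

definition exps :: "column multiset \<Rightarrow> (nat \<times> nat) \<Rightarrow>\<^sub>0 nat" where
  "exps X = (\<Sum>c\<in>#X. col_exp c)"

lemma exps_add_mset [simp]: "exps (add_mset c X) = col_exp c + exps X"
  and exps_empty [simp]: "exps {#} = 0"
  by (simp_all add: exps_def)

lemma lookup_exps:
  "Poly_Mapping.lookup (exps X) (1, j) = count (image_mset fst X) j"
  "Poly_Mapping.lookup (exps X) (2, j) = count (image_mset (fst \<circ> snd) X) j"
  "Poly_Mapping.lookup (exps X) (3, j) = count (image_mset (snd \<circ> snd) X) j"
  by (induction X; force simp: lookup_add lookup_single when_def)+

lemma lookup_exps_other: "i \<notin> {1, 2, 3} \<Longrightarrow> Poly_Mapping.lookup (exps X) (i, j) = 0"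
  by (induction X) (auto simp: lookup_add lookup_single when_def)

lemma exps_eq_iff: "exps X = exps Y \<longleftrightarrow> rows X = rows Y"
proof
  assume *: "exps X = exps Y"
  then show "rows X = rows Y"
    unfolding rows_def multiset_eq_iff prod.inject
    by (simp only: lookup_exps[symmetric] * simp_thms)
next
  assume *: "rows X = rows Y"
  show "exps X = exps Y"
  proof (rule poly_mapping_eqI)
    fix ij :: "nat \<times> nat"
    obtain i j where ij: "ij = (i, j)" by fastforce
    have "Poly_Mapping.lookup (exps X) (i, j) = Poly_Mapping.lookup (exps Y) (i, j)"
    proof (cases "i \<in> {1, 2, 3}")
      case True
      then consider "i = 1" | "i = 2" | "i = 3" by blast
      then show ?thesis using *[unfolded rows_def prod.inject]
        by cases (simp_all only: lookup_exps)
    next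
      case False
      then show ?thesis by (simp add: lookup_exps_other)
    qed
    then show "Poly_Mapping.lookup (exps X) ij = Poly_Mapping.lookup (exps Y) ij"
      by (simp only: ij)
  qed
qed

lemma size_eq_if_exps_eq: "exps X = exps Y \<Longrightarrow> size X = size Y"
  unfolding exps_eq_iff rows_def prod.inject by (metis size_image_mset)

definition det_prod :: "column multiset \<Rightarrow> (nat \<times> nat, 'k::field) mpoly" where
  "det_prod X = (\<Prod>c\<in>#X. col_det c)"

lemma det_prod_add_mset [simp]: "det_prod (add_mset c X) = col_det c * det_prod X"
  and det_prod_empty [simp]: "det_prod {#} = 1"
  by (simp_all add: det_prod_def)

section \<open>Straightening modulo products of higher weight\<close>

text \<open>A weight \<open>w\<close> for which the matching field with first block \<open>{1..a}\<close> picks the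
initial forms.  The parameter \<open>K\<close> carries the coefficient field.\<close>

locale leading_columns =
  fixes a n :: nat and w :: "nat \<times> nat \<Rightarrow> real" and K :: "'k::field itself"
  assumes leads_col_det: "c \<in> columns a n \<Longrightarrow> leads w (col_det c :: (nat \<times> nat, 'k) mpoly) (col_exp c)"

context leading_columns
begin

abbreviation weight :: "column multiset \<Rightarrow> real" where
  "weight X \<equiv> mon_weight w (exps X)"

text \<open>The number \<open>d\<close> of columns is recorded because there are only finitely many collections of a
given size, which makes straightening terminate.\<close>

definition higher :: "nat \<Rightarrow> real \<Rightarrow> (nat \<times> nat, 'k) mpoly set" where
  "higher d t = mpoly.span {det_prod Z | Z. set_mset Z \<subseteq> columns a n \<and> size Z = d \<and> t < weight Z}"

lemma leads_det_prod:
  "set_mset X \<subseteq> columns a n \<Longrightarrow> leads w (det_prod X :: (nat \<times> nat, 'k) mpoly) (exps X)"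
  by (induction X) (simp_all add: leads_one leads_mult leads_col_det)

lemma higherI:
  "set_mset Z \<subseteq> columns a n \<Longrightarrow> size Z = d \<Longrightarrow> t < weight Z \<Longrightarrow> det_prod Z \<in> higher d t"
  unfolding higher_def by (intro mpoly.span_base) blast

lemma higher_zero: "0 \<in> higher d t"
  and higher_add: "f \<in> higher d t \<Longrightarrow> g \<in> higher d t \<Longrightarrow> f + g \<in> higher d t"
  and higher_scale: "f \<in> higher d t \<Longrightarrow> scale \<sigma> f \<in> higher d t"
  unfolding higher_def by (rule mpoly.span_zero mpoly.span_add mpoly.span_scale; assumption)+

lemma higher_mult:
  assumes c: "c \<in> columns a n" and f: "f \<in> higher d t"
  shows "col_det c * f \<in> higher (Suc d) (mon_weight w (col_exp c) + t)"
proof -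
  let ?S = "{f. col_det c * f \<in> higher (Suc d) (mon_weight w (col_exp c) + t)}"
  have "mpoly.subspace ?S"
    by (auto intro!: mpoly.subspaceI higher_zero higher_add higher_scale
        simp: distrib_left scale_mult_right)
  moreover have "det_prod Z \<in> ?S" if "set_mset Z \<subseteq> columns a n" "size Z = d" "t < weight Z" for Z
    using higherI[of "add_mset c Z" "Suc d" "mon_weight w (col_exp c) + t"] c that
    by (simp add: mon_weight_add)
  ultimately have "mpoly.span {det_prod Z | Z. set_mset Z \<subseteq> columns a n \<and> size Z = d \<and> t < weight Z} \<subseteq> ?S"
    by (intro mpoly.span_minimal) auto
  with f show ?thesis unfolding higher_def by blast
qed

lemma product_cases:
  assumes "entries A \<subseteq> {1..n}" "entries B \<subseteq> {1..n}"
  obtains "col_det A * col_det B = (0 :: (nat \<times> nat, 'k) mpoly)"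
  | X \<sigma> where "set_mset X \<subseteq> columns a n" "size X = 2" "\<sigma> \<noteq> 0"
    "col_det A * col_det B = scale \<sigma> (det_prod X :: (nat \<times> nat, 'k) mpoly)"
    "image_mset (snd \<circ> snd) X = {#top_entry A, top_entry B#}"
proof (cases rule: col_det_cases[OF assms(1), where ?'k = 'k and a = a])
  case (2 u \<sigma>)
  note u = this
  show ?thesis
  proof (cases rule: col_det_cases[OF assms(2), where ?'k = 'k and a = a])
    case (2 v \<tau>)
    show ?thesis
      using u 2 that(2)[of "{#u, v#}" "\<sigma> * \<tau>"]
      by (simp add: scale_mult_left scale_mult_right mult.commute)
  qed (use that(1) in simp)
qed (use that(1) in simp)

text \<open>The left side of an exchange relation has weight above that of its cancelling leading terms.
This passes to the two products on the right, unless they could cancel each other, which would require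
them to have equal leading exponents and in particular the same entries in the third row.\<close>

lemma exchange_in_higher:
  assumes X: "set_mset X \<subseteq> columns a n" "size X = 2" and Y: "set_mset Y \<subseteq> columns a n"
    and XY: "exps X = exps Y"
    and eq: "det_prod X - det_prod Y = col_det A1 * col_det B1 + col_det A2 * (col_det B2 :: (nat \<times> nat, 'k) mpoly)"
    and "entries A1 \<subseteq> {1..n}" "entries B1 \<subseteq> {1..n}" "entries A2 \<subseteq> {1..n}" "entries B2 \<subseteq> {1..n}"
    and ne: "col_det A1 * col_det B1 = (0 :: (nat \<times> nat, 'k) mpoly) \<or>
      col_det A2 * col_det B2 = (0 :: (nat \<times> nat, 'k) mpoly) \<or>
      {#top_entry A1, top_entry B1#} \<noteq> {#top_entry A2, top_entry B2#}"
  shows "det_prod X - det_prod Y \<in> higher 2 (weight X)"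
proof -
  let ?f = "det_prod X - det_prod Y :: (nat \<times> nat, 'k) mpoly"
  \<comment> \<open>Both products lead with \<open>exps X\<close>, so their leading terms cancel in the difference.\<close>
  have "terms_above w (weight X) ?f"
    using terms_above_diff leads_det_prod[OF X(1)] leads_det_prod[OF Y]
    unfolding leads_def XY by (metis (no_types, lifting) diff_diff_eq2 diff_add_cancel)
  note ab = this[unfolded eq]
  show ?thesis
  proof (cases rule: product_cases[OF \<open>entries A1 \<subseteq> {1..n}\<close> \<open>entries B1 \<subseteq> {1..n}\<close>])
    case 1
    note zero1 = this
    show ?thesis
    proof (cases rule: product_cases[OF \<open>entries A2 \<subseteq> {1..n}\<close> \<open>entries B2 \<subseteq> {1..n}\<close>])
      case 1
      with zero1 show ?thesis unfolding eq by (simp only: add_0 higher_zero)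
    next
      case (2 Z \<sigma>)
      with zero1 ab show ?thesis
        unfolding eq using leads_scale_above[OF leads_det_prod[OF 2(1)]]
        by (auto intro!: higher_scale higherI)
    qed
  next
    case (2 Z \<sigma>)
    note Z = this
    show ?thesis
    proof (cases rule: product_cases[OF \<open>entries A2 \<subseteq> {1..n}\<close> \<open>entries B2 \<subseteq> {1..n}\<close>])
      case 1
      with Z ab show ?thesis
        unfolding eq using leads_scale_above[OF leads_det_prod[OF Z(1)]]
        by (auto intro!: higher_scale higherI)
    next
      case (2 Z' \<sigma>')
      have nz: "scale \<tau> (det_prod W) \<noteq> (0 :: (nat \<times> nat, 'k) mpoly)"
        if "set_mset W \<subseteq> columns a n" "\<tau> \<noteq> 0" for W \<tau>
        using leads_lookup[OF leads_det_prod[OF that(1)], of "exps W"] that(2) by auto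
      have "exps Z \<noteq> exps Z'"
        using ne nz[OF Z(1,3)] nz[OF 2(1,3)] Z(4,5) 2(4,5)
        unfolding exps_eq_iff by (auto simp: rows_def)
      with ab Z 2 have "weight X < weight Z \<and> weight X < weight Z'"
        by (intro leads_scale_sum_above[OF leads_det_prod[OF Z(1)] Z(3) leads_det_prod[OF 2(1)] 2(3)]) simp_all
      with Z 2 show ?thesis
        unfolding eq by (auto intro!: higher_add higher_scale higherI)
    qed
  qed
qed

text \<open>With \<open>t < r\<close>, the third row entries on the right are \<open>{r, u}\<close> for the first product, whereas the second
one has an entry below both \<open>r\<close> and \<open>u\<close>.  If \<open>t \<ge> r\<close>, then \<open>q < r \<le> t < u\<close>, so the condition holds with the
two columns interchanged.\<close>

lemma swap_row1_in_higher:
  assumes cols: "{(p, q, r), (s, t, u), (s, q, r), (p, t, u)} \<subseteq> columns a n"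
  shows "det_prod {#(p, q, r), (s, t, u)#} - det_prod {#(s, q, r), (p, t, u)#}
    \<in> higher 2 (weight {#(p, q, r), (s, t, u)#})"
proof -
  have *: "det_prod {#(p, q, r), (s, t, u)#} - det_prod {#(s, q, r), (p, t, u)#} \<in> higher 2 (weight {#(p, q, r), (s, t, u)#})"
    if "{(p, q, r), (s, t, u), (s, q, r), (p, t, u)} \<subseteq> columns a n" "t < r" for p q r s t u
  proof (rule exchange_in_higher)
    show "det_prod {#(p, q, r), (s, t, u)#} - det_prod {#(s, q, r), (p, t, u)#}
      = col_det (t, q, r) * col_det (s, p, u) + col_det (u, q, r) * (col_det (s, t, p) :: (nat \<times> nat, 'k) mpoly)"
      using exchange_entry1[of p q r s t u] by (simp del: col_det.simps)
    have "{#top_entry (t, q, r), top_entry (s, p, u)#} \<noteq> {#top_entry (u, q, r), top_entry (s, t, p)#}"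
      using that by (intro pair_neq) (auto simp: columns_def)
    then show "col_det (t, q, r) * col_det (s, p, u) = (0 :: (nat \<times> nat, 'k) mpoly) \<or>
      col_det (u, q, r) * col_det (s, t, p) = (0 :: (nat \<times> nat, 'k) mpoly) \<or>
      {#top_entry (t, q, r), top_entry (s, p, u)#} \<noteq> {#top_entry (u, q, r), top_entry (s, t, p)#}"
      by blast
  qed (use that in \<open>auto simp: columns_def exps_eq_iff rows_def add_mset_commute simp del: exps_add_mset\<close>)
  show ?thesis
  proof (cases "t < r")
    case False
    then have "q < u" using cols by (auto simp: columns_def)
    then show ?thesis
      using *[of s t u p q r] cols by (simp add: add_mset_commute mult.commute add_ac del: col_det.simps)
  qed (use * cols in blast)
qed

text \<open>The argument for the first row, with the roles of the first two rows interchanged.\<close>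

lemma swap_row2_in_higher:
  assumes cols: "{(p, q, r), (s, t, u), (p, t, r), (s, q, u)} \<subseteq> columns a n"
  shows "det_prod {#(p, q, r), (s, t, u)#} - det_prod {#(p, t, r), (s, q, u)#}
    \<in> higher 2 (weight {#(p, q, r), (s, t, u)#})"
proof -
  have *: "det_prod {#(p, q, r), (s, t, u)#} - det_prod {#(p, t, r), (s, q, u)#} \<in> higher 2 (weight {#(p, q, r), (s, t, u)#})"
    if "{(p, q, r), (s, t, u), (p, t, r), (s, q, u)} \<subseteq> columns a n" "s < r" for p q r s t u
  proof (rule exchange_in_higher)
    show "det_prod {#(p, q, r), (s, t, u)#} - det_prod {#(p, t, r), (s, q, u)#}
      = col_det (p, s, r) * col_det (q, t, u) + col_det (p, u, r) * (col_det (s, t, q) :: (nat \<times> nat, 'k) mpoly)"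
      using exchange_entry2[of p q r s t u] by (simp del: col_det.simps)
    have "{#top_entry (p, s, r), top_entry (q, t, u)#} \<noteq> {#top_entry (p, u, r), top_entry (s, t, q)#}"
      using that by (intro pair_neq) (auto simp: columns_def)
    then show "col_det (p, s, r) * col_det (q, t, u) = (0 :: (nat \<times> nat, 'k) mpoly) \<or>
      col_det (p, u, r) * col_det (s, t, q) = (0 :: (nat \<times> nat, 'k) mpoly) \<or>
      {#top_entry (p, s, r), top_entry (q, t, u)#} \<noteq> {#top_entry (p, u, r), top_entry (s, t, q)#}"
      by blast
  qed (use that in \<open>auto simp: columns_def exps_eq_iff rows_def add_mset_commute simp del: exps_add_mset\<close>)
  show ?thesis
  proof (cases "s < r")
    case False
    then have "p < u" using cols by (auto simp: columns_def)
    then show ?thesis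
      using *[of s t u p q r] cols by (simp add: add_mset_commute mult.commute add_ac del: col_det.simps)
  qed (use * cols in blast)
qed

text \<open>Exchanging \<open>r\<close> with \<open>s\<close> and with \<open>t\<close> leaves \<open>max p q s\<close> and \<open>max p q t\<close>, respectively, in the
third row next to the larger of \<open>r\<close> and \<open>u\<close>.  If \<open>max p q \<le> max s t\<close>, these two can only agree when
\<open>max p q = max s t\<close>, and then \<open>s\<close> or \<open>t\<close> equals \<open>p\<close> or \<open>q\<close>, so that one of the products vanishes.
The remaining case is obtained by interchanging the columns.\<close>

lemma swap_row3_in_higher:
  assumes cols: "{(p, q, r), (s, t, u), (p, q, u), (s, t, r)} \<subseteq> columns a n"
  shows "det_prod {#(p, q, r), (s, t, u)#} - det_prod {#(p, q, u), (s, t, r)#}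
    \<in> higher 2 (weight {#(p, q, r), (s, t, u)#})"
proof -
  have *: "det_prod {#(p, q, r), (s, t, u)#} - det_prod {#(p, q, u), (s, t, r)#} \<in> higher 2 (weight {#(p, q, r), (s, t, u)#})"
    if "{(p, q, r), (s, t, u), (p, q, u), (s, t, r)} \<subseteq> columns a n" "max p q \<le> max s t" for p q r s t u
  proof (rule exchange_in_higher)
    show "det_prod {#(p, q, r), (s, t, u)#} - det_prod {#(p, q, u), (s, t, r)#}
      = col_det (p, q, s) * col_det (r, t, u) + col_det (p, q, t) * (col_det (s, r, u) :: (nat \<times> nat, 'k) mpoly)"
      using exchange_entry3[of p q r s t u] by (simp del: col_det.simps)
    have "s \<noteq> t" using that by (auto simp: columns_def precedes_def split: if_splits)
    have "s = p \<or> s = q \<or> t = p \<or> t = q \<or> max s (max p q) \<noteq> max t (max p q)"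
      using \<open>s \<noteq> t\<close> that(2) by arith
    then consider "s \<in> {p, q}" | "t \<in> {p, q}" | "max s (max p q) \<noteq> max t (max p q)"
      by auto
    then show "col_det (p, q, s) * col_det (r, t, u) = (0 :: (nat \<times> nat, 'k) mpoly) \<or>
      col_det (p, q, t) * col_det (s, r, u) = (0 :: (nat \<times> nat, 'k) mpoly) \<or>
      {#top_entry (p, q, s), top_entry (r, t, u)#} \<noteq> {#top_entry (p, q, t), top_entry (s, r, u)#}"
    proof cases
      case 3
      have "{#top_entry (p, q, t), top_entry (s, r, u)#} \<noteq> {#top_entry (r, t, u), top_entry (p, q, s)#}"
        using that 3 by (intro pair_neq) (auto simp: columns_def)
      then show ?thesis by (metis add_mset_commute)
    qed (auto simp: col_det_repeated simp del: col_det.simps)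
  qed (use that in \<open>auto simp: columns_def exps_eq_iff rows_def add_mset_commute simp del: exps_add_mset\<close>)
  show ?thesis
  proof (cases "max p q \<le> max s t")
    case False
    then have "max s t \<le> max p q" by linarith
    then show ?thesis
      using *[of s t u p q r] cols
      by (simp add: add_mset_commute mult.commute add_ac del: col_det.simps max.bounded_iff)
  qed (use * cols in blast)
qed

lemma swap_connected_in_higher:
  assumes "swap_connected a n X Y"
  shows "det_prod X - det_prod Y \<in> higher (size X) (weight X)"
  using assms
proof (induction rule: swap_connected.induct)
  case (sym X Y)
  have "exps X = exps Y" using swap_connected_rows[OF sym(1)] exps_eq_iff by blast
  with sym higher_scale[of "det_prod X - det_prod Y" _ _ "- 1"] show ?case
    by (simp add: scale_minus_one size_eq_if_exps_eq[of X Y])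
next
  case (trans X Y Z)
  have "exps X = exps Y" using swap_connected_rows[OF trans(1)] exps_eq_iff by blast
  with trans higher_add[of "det_prod X - det_prod Y" _ _ "det_prod Y - det_prod Z"] show ?case
    by (simp add: size_eq_if_exps_eq[of X Y])
next
  case (add c X Y)
  then show ?case
    using higher_mult[OF add(1) add.IH] by (simp add: mon_weight_add right_diff_distrib)
qed (use swap_row1_in_higher swap_row2_in_higher swap_row3_in_higher higher_zero in
    \<open>simp_all add: numeral_2_eq_2\<close>)

text \<open>The straightening law: up to heavier products, a product of columns depends only on its leading
exponent.\<close>

theorem equal_exps_in_higher:
  assumes "set_mset X \<subseteq> columns a n" "set_mset Y \<subseteq> columns a n" "exps X = exps Y"
  shows "det_prod X - det_prod Y \<in> higher (size X) (weight X)"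
  using assms swap_connected_if_same_rows swap_connected_in_higher unfolding exps_eq_iff by blast

section \<open>Initial forms of the span of the column products\<close>

text \<open>One collection of columns for each exponent, chosen arbitrarily.\<close>

definition standard :: "((nat \<times> nat) \<Rightarrow>\<^sub>0 nat) \<Rightarrow> column multiset" where
  "standard e = (SOME Y. set_mset Y \<subseteq> columns a n \<and> exps Y = e)"

lemma standard_columns:
  assumes "set_mset X \<subseteq> columns a n"
  shows "set_mset (standard (exps X)) \<subseteq> columns a n" "exps (standard (exps X)) = exps X"
  using someI[of "\<lambda>Y. set_mset Y \<subseteq> columns a n \<and> exps Y = exps X" X] assms
  by (auto simp: standard_def)

definition column_exps :: "((nat \<times> nat) \<Rightarrow>\<^sub>0 nat) set" where
  "column_exps = exps ` {X. set_mset X \<subseteq> columns a n}"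

lemma finite_column_multisets: "finite {Z. set_mset Z \<subseteq> columns a n \<and> size Z = d}"
proof (rule finite_subset)
  show "{Z. set_mset Z \<subseteq> columns a n \<and> size Z = d} \<subseteq> mset ` {xs. set xs \<subseteq> columns a n \<and> length xs = d}"
  proof
    fix Z assume Z: "Z \<in> {Z. set_mset Z \<subseteq> columns a n \<and> size Z = d}"
    obtain xs where "mset xs = Z" using ex_mset by blast
    with Z show "Z \<in> mset ` {xs. set xs \<subseteq> columns a n \<and> length xs = d}" by auto
  qed
qed (simp add: finite_columns finite_lists_length_eq)

text \<open>Replacing a product by the chosen one with the same exponent costs only heavier products of the same
size, of which there are finitely many.\<close>

lemma det_prod_in_standard_span:
  assumes "set_mset X \<subseteq> columns a n"
  shows "det_prod X \<in> mpoly.span ((\<lambda>e. det_prod (standard e) :: (nat \<times> nat, 'k) mpoly) ` column_exps)"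
    (is "_ \<in> ?S")
  using assms
proof (induction "card {Z. set_mset Z \<subseteq> columns a n \<and> size Z = size X \<and> weight X < weight Z}"
    arbitrary: X rule: less_induct)
  case less
  have sub: "mpoly.subspace ?S" by simp
  have "higher (size X) (weight X) \<subseteq> ?S"
    unfolding higher_def
  proof (rule mpoly.span_minimal[OF _ sub], safe)
    fix Z assume Z: "set_mset Z \<subseteq> columns a n" "size Z = size X" "weight X < weight Z"
    \<comment> \<open>The induction measure counts the heavier collections of the same size.\<close>
    have "card {Y. set_mset Y \<subseteq> columns a n \<and> size Y = size Z \<and> weight Z < weight Y}
        < card {Y. set_mset Y \<subseteq> columns a n \<and> size Y = size X \<and> weight X < weight Y}"
    proof (rule psubset_card_mono)
      show "finite {Y. set_mset Y \<subseteq> columns a n \<and> size Y = size X \<and> weight X < weight Y}"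
        by (rule finite_subset[OF _ finite_column_multisets[of "size X"]]) auto
      show "{Y. set_mset Y \<subseteq> columns a n \<and> size Y = size Z \<and> weight Z < weight Y}
        \<subset> {Y. set_mset Y \<subseteq> columns a n \<and> size Y = size X \<and> weight X < weight Y}"
        using Z by auto
    qed
    then show "det_prod Z \<in> ?S" using Z(1) by (rule less.hyps)
  qed
  then have "det_prod X - det_prod (standard (exps X)) \<in> ?S"
    using equal_exps_in_higher[OF less.prems standard_columns(1)[OF less.prems]] standard_columns(2)[OF less.prems]
    by auto
  moreover have "det_prod (standard (exps X)) \<in> ?S"
    using less.prems by (auto intro!: mpoly.span_base simp: column_exps_def)
  ultimately have "det_prod X - det_prod (standard (exps X)) + det_prod (standard (exps X)) \<in> ?S"
    by (rule mpoly.span_add)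
  then show ?case by simp
qed

lemma leads_standard:
  assumes "e \<in> column_exps"
  shows "leads w (det_prod (standard e) :: (nat \<times> nat, 'k) mpoly) e"
proof -
  obtain X where X: "set_mset X \<subseteq> columns a n" "e = exps X"
    using assms by (auto simp: column_exps_def)
  show ?thesis
    using leads_det_prod[OF standard_columns(1)[OF X(1)]] standard_columns(2)[OF X(1)] X(2) by simp
qed

text \<open>Since the standard products have pairwise different leading exponents, the lightest of those that occur
in \<open>f\<close> cannot cancel; the initial form consists of exactly their leading monomials.\<close>

lemma init_form_in_span:
  assumes "f \<in> mpoly.span {det_prod X | X. set_mset X \<subseteq> columns a n}"
  shows "init_form w f \<in> mpoly.span ((\<lambda>e. Poly_Mapping.single e (1::'k)) ` column_exps)"
proof -
  let ?D = "\<lambda>e. det_prod (standard e) :: (nat \<times> nat, 'k) mpoly"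
  have "mpoly.span {det_prod X | X. set_mset X \<subseteq> columns a n} \<subseteq> mpoly.span (?D ` column_exps)"
    using det_prod_in_standard_span by (intro mpoly.span_minimal) auto
  with assms have "f \<in> mpoly.span (?D ` column_exps)" by blast
  then obtain S0 c where S0: "finite S0" "S0 \<subseteq> column_exps" "f = (\<Sum>e\<in>S0. scale (c e) (?D e))"
    by (rule span_image_explicit)
  define S where "S = {e \<in> S0. c e \<noteq> 0}"
  have S: "finite S" "S \<subseteq> column_exps" and c: "\<And>e. e \<in> S \<Longrightarrow> c e \<noteq> 0"
    using S0 by (auto simp: S_def)
  have f: "f = (\<Sum>e\<in>S. scale (c e) (?D e))"
    unfolding S0(3) S_def by (rule sum.mono_neutral_right) (use S0 in auto)
  have lookup_f: "Poly_Mapping.lookup f m = (\<Sum>e\<in>S. c e * Poly_Mapping.lookup (?D e) m)" for m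
    unfolding f by (simp add: lookup_sum lookup_scale)
  have lookup_low: "Poly_Mapping.lookup f m = (if m \<in> S then c m else 0)"
    if "\<And>e. e \<in> S \<Longrightarrow> mon_weight w m \<le> mon_weight w e" for m
  proof -
    have "Poly_Mapping.lookup f m = (\<Sum>e\<in>S. if m = e then c e else 0)"
      unfolding lookup_f
    proof (rule sum.cong[OF HOL.refl])
      fix e assume "e \<in> S"
      with S(2) have "Poly_Mapping.lookup (?D e) m = (if m = e then 1 else 0)"
        by (intro leads_lookup[OF leads_standard] that) auto
      then show "c e * Poly_Mapping.lookup (?D e) m = (if m = e then c e else 0)" by simp
    qed
    also have "\<dots> = (if m \<in> S then c m else 0)"
      using S(1) by (simp add: sum.delta)
    finally show ?thesis .
  qed
  \<comment> \<open>A lightest exponent \<open>e0\<close> of the sum survives and bounds the weight of the initial form.\<close>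
  have keys_init: "m \<in> column_exps" if m: "m \<in> Poly_Mapping.keys (init_form w f)" for m
  proof -
    from m have fm: "Poly_Mapping.lookup f m \<noteq> 0"
      and min: "\<And>m'. m' \<in> Poly_Mapping.keys f \<Longrightarrow> mon_weight w m \<le> mon_weight w m'"
      by (auto simp: in_keys_iff lookup_init_form split: if_splits)
    have "S \<noteq> {}" using fm by (auto simp: lookup_f)
    then obtain e0 where e0: "e0 \<in> S" "\<And>e. e \<in> S \<Longrightarrow> mon_weight w e0 \<le> mon_weight w e"
      using arg_min_if_finite[OF S(1), of "mon_weight w"] by (metis not_le)
    then have "Poly_Mapping.lookup f e0 = c e0" using lookup_low[of e0] by simp
    with c[OF e0(1)] have "mon_weight w m \<le> mon_weight w e0" by (intro min) (simp add: in_keys_iff)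
    with e0(2) lookup_low[of m] fm S(2) show ?thesis by (force split: if_splits)
  qed
  have "init_form w f = (\<Sum>m\<in>Poly_Mapping.keys (init_form w f).
      scale (Poly_Mapping.lookup (init_form w f) m) (Poly_Mapping.single m 1))"
    by (rule sum_monomials[symmetric])
  also have "\<dots> \<in> mpoly.span ((\<lambda>e. Poly_Mapping.single e 1) ` column_exps)"
    using keys_init by (intro mpoly.span_sum mpoly.span_scale mpoly.span_base) auto
  finally show ?thesis .
qed

end

section \<open>Triples, columns and Pluecker forms\<close>

lemma sorted_list_of_three:
  assumes "x < y" "y < z"
  shows "sorted_list_of_set {x, y, z :: nat} = [x, y, z]"
  using assms by (simp add: sorted_list_of_set_insert_remove insert_Diff_if)

lemma triple_sorted:
  assumes "I \<in> triples n"
  obtains x y z where "I = {x, y, z}" "x < y" "y < z" "1 \<le> x" "z \<le> n"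
proof -
  have I: "I \<subseteq> {1..n}" "card I = 3" using assms by (auto simp: triples_def)
  then have fin: "finite I" using finite_subset by blast
  have "length (sorted_list_of_set I) = 3" using I by simp
  then obtain x y z where l: "sorted_list_of_set I = [x, y, z]"
    by (metis length_0_conv length_Suc_conv numeral_3_eq_3)
  have "sorted_wrt (<) (sorted_list_of_set I)" by (rule strict_sorted_list_of_set)
  with l have "x < y" "y < z" by auto
  moreover have "I = {x, y, z}" using set_sorted_list_of_set[OF fin] l by simp
  ultimately show ?thesis using that I by auto
qed

lemma entries_triples:
  assumes "c \<in> columns a n"
  shows "entries c \<in> triples n"
  using assms by (cases c) (auto simp: columns_def triples_def precedes_def card_insert_if split: if_splits)

lemma column_of_triple:
  assumes "I \<in> triples n"
  obtains c where "c \<in> columns a n" "entries c = I"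
proof -
  obtain x y z where xyz: "I = {x, y, z}" "x < y" "y < z" "1 \<le> x" "z \<le> n"
    using assms by (rule triple_sorted)
  from precedes_total[of x y a] xyz(2) have "precedes a x y \<or> precedes a y x" by simp
  then show ?thesis
  proof
    assume "precedes a x y"
    with xyz that[of "(x, y, z)"] show ?thesis by (simp add: columns_def)
  next
    assume "precedes a y x"
    with xyz that[of "(y, x, z)"] show ?thesis by (auto simp: columns_def insert_commute)
  qed
qed

lemma det_mat_2: "Determinant.det (mat 2 2 f) = f (0, 0) * f (1, 1) - f (0, 1) * (f (1, 0) :: 'a::comm_ring_1)"
proof -
  have "mat_delete (mat 2 2 f) i 0 = mat 1 1 (\<lambda>_. f (1 - i, 1))" if "i < 2" for i
    using that by (intro eq_matI) (auto simp: mat_delete_def)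
  then show ?thesis
    using laplace_expansion_column[of "mat 2 2 f" 2 0]
    by (simp add: cofactor_def det_single numeral_2_eq_2 algebra_simps)
qed

lemma det_mat_3:
  "Determinant.det (mat 3 3 f) =
     f (0, 0) * (f (1, 1) * f (2, 2) - f (1, 2) * f (2, 1))
   - f (1, 0) * (f (0, 1) * f (2, 2) - f (0, 2) * f (2, 1))
   + f (2, 0) * (f (0, 1) * f (1, 2) - f (0, 2) * (f (1, 1) :: 'a::comm_ring_1))"
proof -
  have "mat_delete (mat 3 3 f) i 0 = mat 2 2 (\<lambda>(k, l). f (if k < i then k else Suc k, Suc l))"
    if "i < 3" for i
    using that by (intro eq_matI) (auto simp: mat_delete_def)
  moreover have "Determinant.det (mat 3 3 f) = (\<Sum>i<3. mat 3 3 f $$ (i, 0) * cofactor (mat 3 3 f) i 0)"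
    by (rule laplace_expansion_column) auto
  moreover have "{..<3::nat} = {0, 1, 2}" by auto
  ultimately show ?thesis
    by (simp add: cofactor_def det_mat_2 numeral_2_eq_2[symmetric] Suc_1 algebra_simps)
qed

lemma plucker_form_sorted:
  assumes "x < y" "y < z"
  shows "plucker_form {x, y, z} = (col_det (x, y, z) :: (nat \<times> nat, 'k::field) mpoly)"
proof -
  have "sorted_list_of_set {x, y, z} = [x, y, z]"
    using assms by (rule sorted_list_of_three)
  then have col: "Defs.col {x, y, z} (Suc 0) = x" "Defs.col {x, y, z} 2 = y" "Defs.col {x, y, z} 3 = z"
    by (simp_all add: Defs.col_def)
  show ?thesis
    by (simp add: plucker_form_def det_mat_3 col algebra_simps flip: numeral_2_eq_2)
qed

text \<open>The sign of the permutation that sorts a column; only the first two entries can be out of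
order.\<close>

fun col_sign :: "column \<Rightarrow> 'k::field" where
  "col_sign (p, q, r) = (if p < q then 1 else - 1)"

lemma col_sign_cases: "col_sign c = (1 :: 'k::field) \<or> col_sign c = (- 1 :: 'k)"
  by (cases c) simp

lemma col_sign_square [simp]: "col_sign c * col_sign c = 1"
  by (cases c) simp

lemma plucker_form_entries:
  assumes "c \<in> columns a n"
  shows "plucker_form (entries c) = scale (col_sign c) (col_det c :: (nat \<times> nat, 'k::field) mpoly)"
proof -
  obtain p q r where c: "c = (p, q, r)" by (cases c)
  with assms have *: "p \<noteq> q" "p < r" "q < r" by (auto simp: columns_def precedes_def split: if_splits)
  show ?thesis
  proof (cases "p < q")
    case True
    with * show ?thesis by (simp add: c plucker_form_sorted del: col_det.simps)
  next
    case False
    then have "plucker_form {q, p, r} = (col_det (q, p, r) :: (nat \<times> nat, 'k) mpoly)"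
      using * by (intro plucker_form_sorted) auto
    moreover have "{q, p, r} = entries c" by (auto simp: c)
    ultimately show ?thesis
      using False col_det_swap12[of q p r] by (simp add: c scale_minus_one del: col_det.simps)
  qed
qed

context leading_columns
begin

abbreviation init_plucker :: "nat set \<Rightarrow> (nat \<times> nat, 'k) mpoly" where
  "init_plucker I \<equiv> init_form w (plucker_form I)"

lemma init_plucker_entries:
  assumes "c \<in> columns a n"
  shows "init_plucker (entries c) = scale (col_sign c) (Poly_Mapping.single (col_exp c) 1)"
  using init_form_of_leads[OF leads_col_det[OF assms]]
  by (simp add: plucker_form_entries[OF assms] init_form_scale)

definition triple_weight :: "nat set \<Rightarrow> real" where
  "triple_weight I = form_weight w (init_plucker I)"

lemma triple_weight_entries:
  assumes "c \<in> columns a n"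
  shows "triple_weight (entries c) = mon_weight w (col_exp c)"
  using col_sign_cases[of c, where ?'k = 'k]
  by (auto simp: triple_weight_def form_weight_def init_plucker_entries[OF assms] scale_single)

text \<open>The Pluecker variable of the set of entries, with the sign that makes it map to \<open>col_det c\<close>.
With this sign it also maps to the plain monomial \<open>col_exp c\<close> when \<open>P\<^sub>I\<close> is sent to the initial form.\<close>

definition col_var :: "column \<Rightarrow> (nat set, 'k) mpoly" where
  "col_var c = scale (col_sign c) (Var (entries c))"

definition var_prod :: "column multiset \<Rightarrow> (nat set, 'k) mpoly" where
  "var_prod X = (\<Prod>c\<in>#X. col_var c)"

lemma var_prod_add_mset [simp]: "var_prod (add_mset c X) = col_var c * var_prod X"
  and var_prod_empty [simp]: "var_prod {#} = 1"
  by (simp_all add: var_prod_def)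

lemma var_prod_union: "var_prod (X + Y) = var_prod X * var_prod Y"
  by (simp add: var_prod_def)

lemma subst_plucker_var_prod:
  "set_mset X \<subseteq> columns a n \<Longrightarrow> subst plucker_form (var_prod X) = (det_prod X :: (nat \<times> nat, 'k) mpoly)"
  by (induction X)
    (simp_all add: subst_mult col_var_def subst_scale plucker_form_entries[where a = a and n = n] del: col_det.simps)

lemma subst_init_var_prod:
  "set_mset X \<subseteq> columns a n \<Longrightarrow> subst init_plucker (var_prod X) = Poly_Mapping.single (exps X) 1"
  by (induction X)
    (simp_all add: subst_mult col_var_def subst_scale init_plucker_entries scale_mult_left mult_single)

lemma var_prod_monomial:
  assumes "set_mset X \<subseteq> columns a n"
  obtains \<sigma> m where "\<sigma> = 1 \<or> \<sigma> = - 1" "var_prod X = Poly_Mapping.single m \<sigma>"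
    "mon_weight triple_weight m = weight X" "Poly_Mapping.keys m \<subseteq> triples n"
proof -
  have "\<exists>\<sigma> m. (\<sigma> = 1 \<or> \<sigma> = - 1) \<and> var_prod X = Poly_Mapping.single m \<sigma> \<and>
    mon_weight triple_weight m = weight X \<and> Poly_Mapping.keys m \<subseteq> triples n"
    using assms
  proof (induction X)
    case empty
    show ?case by (intro exI[of _ 1] exI[of _ 0]) simp
  next
    case (add c X)
    then obtain \<sigma> m where IH: "\<sigma> = 1 \<or> \<sigma> = - 1" "var_prod X = Poly_Mapping.single m \<sigma>"
      "mon_weight triple_weight m = weight X" "Poly_Mapping.keys m \<subseteq> triples n" by auto
    have c: "c \<in> columns a n" using add.prems by simp
    let ?m = "Poly_Mapping.single (entries c) 1 + m"
    have "var_prod (add_mset c X) = Poly_Mapping.single ?m (col_sign c * \<sigma>)"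
      by (simp add: IH col_var_def Var_def scale_single mult_single)
    moreover have "mon_weight triple_weight ?m = weight (add_mset c X)"
      using c by (simp add: mon_weight_add mon_weight_single triple_weight_entries IH)
    moreover have "Poly_Mapping.keys ?m \<subseteq> triples n"
      using keys_add[of "Poly_Mapping.single (entries c) 1" m] entries_triples[OF c] IH(4) by auto
    moreover have "col_sign c * \<sigma> = 1 \<or> col_sign c * \<sigma> = - 1"
      using col_sign_cases[of c, where ?'k = 'k] IH(1) by auto
    ultimately show ?case by blast
  qed
  with that show ?thesis by blast
qed

lemma var_prod_carrier: "set_mset X \<subseteq> columns a n \<Longrightarrow> var_prod X \<in> carrier (poly_ring (triples n))"
  by (induction X)
    (auto simp: col_var_def intro!: carrier_one carrier_mult carrier_scale carrier_Var entries_triples)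

text \<open>Replacing each triple by its column turns monomials into products of columns.  The weights agree,
so light terms of a polynomial in the Pluecker variables correspond to light leading terms of its image.\<close>

lemma monomial_var_prod:
  assumes "Poly_Mapping.keys m \<subseteq> triples n"
  shows "\<exists>X \<sigma>. set_mset X \<subseteq> columns a n \<and> (\<sigma> = 1 \<or> \<sigma> = - 1) \<and>
    Poly_Mapping.single m 1 = scale \<sigma> (var_prod X) \<and> mon_weight triple_weight m = weight X"
  using assms
proof (induction m rule: exponent_induct)
  case zero
  show ?case by (intro exI[of _ "{#}"] exI[of _ 1]) simp
next
  case (add m m')
  then obtain X \<sigma> Y \<tau> where X: "set_mset X \<subseteq> columns a n" "\<sigma> = 1 \<or> \<sigma> = - 1"
    "Poly_Mapping.single m 1 = scale \<sigma> (var_prod X)" "mon_weight triple_weight m = weight X"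
    and Y: "set_mset Y \<subseteq> columns a n" "\<tau> = 1 \<or> \<tau> = - 1"
    "Poly_Mapping.single m' 1 = scale \<tau> (var_prod Y)" "mon_weight triple_weight m' = weight Y"
    by metis
  have "Poly_Mapping.single (m + m') 1 = Poly_Mapping.single m 1 * Poly_Mapping.single m' (1::'k)"
    by (simp add: mult_single)
  also have "\<dots> = scale (\<sigma> * \<tau>) (var_prod (X + Y))"
    by (simp add: X Y var_prod_union scale_mult_left scale_mult_right mult.commute)
  finally have "Poly_Mapping.single (m + m') 1 = scale (\<sigma> * \<tau>) (var_prod (X + Y))" .
  moreover have "weight (X + Y) = weight X + weight Y"
    by (simp add: exps_def mon_weight_add)
  ultimately show ?case
    using X Y by (intro exI[of _ "X + Y"] exI[of _ "\<sigma> * \<tau>"]) (auto simp: mon_weight_add)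
next
  case (single I)
  then obtain c where c: "c \<in> columns a n" "entries c = I" by (rule column_of_triple)
  have "Var I = scale (col_sign c) (var_prod {#c#})"
    by (simp add: col_var_def c)
  moreover have "mon_weight triple_weight (Poly_Mapping.single I 1) = weight {#c#}"
    using triple_weight_entries[OF c(1)] c(2) by (simp add: mon_weight_single)
  ultimately show ?case
    using c(1) col_sign_cases[of c, where ?'k = 'k] by (intro exI[of _ "{#c#}"] exI[of _ "col_sign c"]) (simp add: Var_def)
qed

lemma carrier_in_span_var_prod:
  assumes "g \<in> carrier (poly_ring (triples n))"
  shows "g \<in> mpoly.span (var_prod ` {X. set_mset X \<subseteq> columns a n})"
proof -
  have "Poly_Mapping.single m 1 \<in> mpoly.span (var_prod ` {X. set_mset X \<subseteq> columns a n})"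
    if "m \<in> Poly_Mapping.keys g" for m
  proof -
    from assms that have "Poly_Mapping.keys m \<subseteq> triples n" by (simp add: in_carrier_iff)
    from monomial_var_prod[OF this] obtain X \<sigma> where "set_mset X \<subseteq> columns a n"
      "Poly_Mapping.single m 1 = scale \<sigma> (var_prod X)" by blast
    then show ?thesis
      using mpoly.span_scale[OF mpoly.span_base, of "var_prod X" _ \<sigma>] by simp
  qed
  then have "(\<Sum>m\<in>Poly_Mapping.keys g. scale (Poly_Mapping.lookup g m) (Poly_Mapping.single m 1))
      \<in> mpoly.span (var_prod ` {X. set_mset X \<subseteq> columns a n})"
    by (intro mpoly.span_sum mpoly.span_scale) auto
  then show ?thesis by (simp add: sum_monomials)
qed

section \<open>The toric ideal\<close>

text \<open>The kernel of \<open>P\<^sub>I \<mapsto> in(P\<^sub>I)\<close>.\<close>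

definition toric_ideal :: "(nat set, 'k) mpoly set" where
  "toric_ideal = {g \<in> carrier (poly_ring (triples n)). subst init_plucker g = 0}"

definition toric_binomials :: "(nat set, 'k) mpoly set" where
  "toric_binomials = {var_prod X - var_prod Y | X Y. set_mset X \<subseteq> columns a n \<and>
     set_mset Y \<subseteq> columns a n \<and> exps X = exps Y \<and> var_prod X \<noteq> var_prod Y}"

lemma in_plucker_ideal_iff:
  "f \<in> plucker_ideal n \<longleftrightarrow> f \<in> carrier (poly_ring (triples n)) \<and> subst plucker_form f = (0 :: (nat \<times> nat, 'k) mpoly)"
  by (simp add: plucker_ideal_def a_kernel_def' poly_ring_simps)

lemma subspace_toric_ideal: "mpoly.subspace toric_ideal"
  by (auto simp: toric_ideal_def intro!: mpoly.subspaceI carrier_zero carrier_add carrier_scale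
      simp: subst_add subst_scale)

lemma toric_binomials_subset: "toric_binomials \<subseteq> toric_ideal"
  by (auto simp: toric_binomials_def toric_ideal_def subst_diff subst_init_var_prod
      intro!: carrier_diff var_prod_carrier)

text \<open>Modulo the binomials every product of variables equals the standard one with the same
exponent.  Standard products map to different monomials, so a combination of them in the kernel is zero.\<close>

lemma toric_ideal_eq_span: "toric_ideal = mpoly.span toric_binomials"
proof
  show "mpoly.span toric_binomials \<subseteq> toric_ideal"
    by (intro mpoly.span_minimal toric_binomials_subset subspace_toric_ideal)
  show "toric_ideal \<subseteq> mpoly.span toric_binomials"
  proof
    fix g assume g: "g \<in> toric_ideal"
    let ?V = "\<lambda>e. var_prod (standard e)"
    let ?T = "{h + k | h k. h \<in> mpoly.span toric_binomials \<and> k \<in> mpoly.span (?V ` column_exps)}"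
    have "mpoly.subspace ?T"
      by (intro mpoly.subspace_sums) auto
    moreover have "var_prod X \<in> ?T" if X: "set_mset X \<subseteq> columns a n" for X
    proof -
      have "var_prod X - ?V (exps X) \<in> mpoly.span toric_binomials"
      proof (cases "var_prod X = ?V (exps X)")
        case False
        then have "var_prod X - ?V (exps X) \<in> toric_binomials"
          unfolding toric_binomials_def using X standard_columns[OF X]
          by (intro CollectI exI[of _ X] exI[of _ "standard (exps X)"]) simp
        then show ?thesis by (rule mpoly.span_base)
      qed (simp add: mpoly.span_zero)
      moreover have "?V (exps X) \<in> mpoly.span (?V ` column_exps)"
        using X by (intro mpoly.span_base) (auto simp: column_exps_def)
      moreover have "var_prod X = (var_prod X - ?V (exps X)) + ?V (exps X)" by simp
      ultimately show ?thesis by blast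
    qed
    ultimately have "mpoly.span (var_prod ` {X. set_mset X \<subseteq> columns a n}) \<subseteq> ?T"
      by (intro mpoly.span_minimal) auto
    then have "g \<in> ?T"
      using g carrier_in_span_var_prod by (auto simp: toric_ideal_def)
    then obtain h k where hk: "g = h + k" "h \<in> mpoly.span toric_binomials" "k \<in> mpoly.span (?V ` column_exps)"
      by blast
    obtain S c where S: "finite S" "S \<subseteq> column_exps" "k = (\<Sum>e\<in>S. scale (c e) (?V e))"
      using hk(3) by (rule span_image_explicit)
    have "subst init_plucker h = 0"
      using hk(2) \<open>mpoly.span toric_binomials \<subseteq> toric_ideal\<close> by (auto simp: toric_ideal_def)
    with g have "subst init_plucker k = 0"
      by (simp add: hk(1) toric_ideal_def subst_add)
    moreover have "subst init_plucker (?V e) = Poly_Mapping.single e 1" if "e \<in> column_exps" for e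
      using that standard_columns by (auto simp: column_exps_def subst_init_var_prod)
    ultimately have zero: "(\<Sum>e\<in>S. scale (c e) (Poly_Mapping.single e 1)) = 0"
      using S(2) by (simp add: S(3) subst_sum subst_scale subset_iff)
    have "c m = 0" if "m \<in> S" for m
    proof -
      have "0 = (\<Sum>e\<in>S. c e * Poly_Mapping.lookup (Poly_Mapping.single e 1) m)"
        using arg_cong[OF zero, of "\<lambda>p. Poly_Mapping.lookup p m"] by (simp add: lookup_sum lookup_scale)
      also have "\<dots> = (\<Sum>e\<in>S. if e = m then c e else 0)"
        by (intro sum.cong) (auto simp: lookup_single)
      finally show ?thesis using that S(1) by simp
    qed
    then have "k = 0" by (simp add: S(3))
    with hk show "g \<in> mpoly.span toric_binomials" by simp
  qed
qed

text \<open>The two products are signed monomials with the same image.  If the monomials agreed, so would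
the signs, and the difference would be zero.\<close>

lemma binomial_toric_binomial:
  assumes "b \<in> toric_binomials"
  shows "is_binomial b"
proof -
  from assms obtain X Y where b: "b = var_prod X - var_prod Y" and X: "set_mset X \<subseteq> columns a n"
    and Y: "set_mset Y \<subseteq> columns a n" and XY: "exps X = exps Y" and ne: "var_prod X \<noteq> var_prod Y"
    by (auto simp: toric_binomials_def)
  obtain \<sigma> m where m: "\<sigma> = 1 \<or> \<sigma> = - 1" "var_prod X = Poly_Mapping.single m \<sigma>"
    using var_prod_monomial[OF X] by metis
  obtain \<tau> m' where m': "\<tau> = 1 \<or> \<tau> = - 1" "var_prod Y = Poly_Mapping.single m' \<tau>"
    using var_prod_monomial[OF Y] by metis
  have "m \<noteq> m'"
  proof
    assume mm: "m = m'"
    have s: "scale \<sigma> (mon_eval init_plucker m) = scale \<tau> (mon_eval init_plucker m)"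
      "scale \<sigma> (mon_eval init_plucker m) = Poly_Mapping.single (exps X) 1"
      using subst_init_var_prod[OF X] subst_init_var_prod[OF Y] XY
        subst_scale[of init_plucker \<sigma> "Poly_Mapping.single m 1"]
        subst_scale[of init_plucker \<tau> "Poly_Mapping.single m 1"]
      by (simp_all add: m m' mm scale_single subst_monomial)
    have "mon_eval init_plucker m \<noteq> 0"
    proof
      assume "mon_eval init_plucker m = 0"
      with s(2) have "Poly_Mapping.single (exps X) (1::'k) = 0" by simp
      then have "Poly_Mapping.lookup (Poly_Mapping.single (exps X) (1::'k)) (exps X) = 0" by simp
      then show False by simp
    qed
    with s(1) have "\<sigma> = \<tau>" by simp
    with ne m m' mm show False by simp
  qed
  moreover have "Poly_Mapping.keys b = {m, m'}"
    using m m' \<open>m \<noteq> m'\<close>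
    by (auto simp: b in_keys_iff lookup_minus lookup_single when_def split: if_splits)
  ultimately show ?thesis by (simp add: is_binomial_def)
qed

text \<open>The part of \<open>subst plucker_form f\<close> in the lowest weight among the terms of \<open>f\<close> comes from the leading
terms of the lightest monomials alone.  It is the image of the initial form of \<open>f\<close>, and it vanishes with
\<open>subst plucker_form f\<close>.\<close>

lemma init_form_plucker_ideal:
  assumes f: "f \<in> plucker_ideal n"
  shows "init_form triple_weight f \<in> toric_ideal"
proof -
  let ?K = "Poly_Mapping.keys f"
  define L where "L = {m \<in> ?K. \<forall>m'\<in>?K. mon_weight triple_weight m \<le> mon_weight triple_weight m'}"
  have carr: "\<forall>m\<in>?K. Poly_Mapping.keys m \<subseteq> triples n" and f0: "subst plucker_form f = (0 :: (nat \<times> nat, 'k) mpoly)"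
    using f by (auto simp: in_plucker_ideal_iff in_carrier_iff)
  from carr have "\<forall>m\<in>?K. \<exists>X \<sigma>. set_mset X \<subseteq> columns a n \<and>
    Poly_Mapping.single m 1 = scale \<sigma> (var_prod X) \<and> mon_weight triple_weight m = weight X"
    using monomial_var_prod by metis
  then obtain X \<sigma> where X: "\<And>m. m \<in> ?K \<Longrightarrow> set_mset (X m) \<subseteq> columns a n"
    "\<And>m. m \<in> ?K \<Longrightarrow> Poly_Mapping.single m 1 = scale (\<sigma> m) (var_prod (X m))"
    "\<And>m. m \<in> ?K \<Longrightarrow> mon_weight triple_weight m = weight (X m)"
    by metis
  define c where "c m = Poly_Mapping.lookup f m * \<sigma> m" for m
  have "subst plucker_form f = (\<Sum>m\<in>?K. scale (c m) (det_prod (X m) :: (nat \<times> nat, 'k) mpoly))"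
  proof -
    have "subst plucker_form f = subst plucker_form
        (\<Sum>m\<in>?K. scale (Poly_Mapping.lookup f m) (Poly_Mapping.single m 1))"
      by (simp add: sum_monomials)
    also have "\<dots> = (\<Sum>m\<in>?K. scale (c m) (det_prod (X m)))"
      unfolding subst_sum
      by (intro sum.cong) (simp_all add: X subst_scale subst_plucker_var_prod c_def)
    finally show ?thesis .
  qed
  with f0 have sum0: "(\<Sum>m\<in>?K. c m * Poly_Mapping.lookup (det_prod (X m) :: (nat \<times> nat, 'k) mpoly) x) = 0" for x
    by (simp flip: lookup_scale lookup_sum)
  have init: "init_form triple_weight f = (\<Sum>m\<in>L. scale (Poly_Mapping.lookup f m) (Poly_Mapping.single m 1))"
    by (simp add: init_form_def L_def scale_single)
  have "L \<subseteq> ?K" by (auto simp: L_def)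
  have "subst init_plucker (init_form triple_weight f)
      = (\<Sum>m\<in>L. scale (c m) (Poly_Mapping.single (exps (X m)) 1))"
    unfolding init subst_sum
  proof (intro sum.cong HOL.refl)
    fix m assume "m \<in> L"
    with \<open>L \<subseteq> ?K\<close> have "m \<in> ?K" by blast
    then show "subst init_plucker (scale (Poly_Mapping.lookup f m) (Poly_Mapping.single m 1))
        = scale (c m) (Poly_Mapping.single (exps (X m)) 1)"
      by (simp add: X subst_scale subst_init_var_prod c_def)
  qed
  also have "\<dots> = 0"
  proof (rule poly_mapping_eqI)
    fix x
    have "Poly_Mapping.lookup (\<Sum>m\<in>L. scale (c m) (Poly_Mapping.single (exps (X m)) 1)) x
        = (\<Sum>m\<in>L. c m * (if exps (X m) = x then 1 else 0))"
      unfolding lookup_sum lookup_scale by (intro sum.cong) (auto simp: lookup_single when_def)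
    also have "\<dots> = 0"
    proof (cases "\<exists>m0\<in>L. exps (X m0) = x")
      case True
      then obtain m0 where m0: "m0 \<in> L" "exps (X m0) = x" by blast
      \<comment> \<open>No product is lighter than \<open>x\<close>, so only leading exponents can equal \<open>x\<close>.\<close>
      have le: "mon_weight w x \<le> weight (X m)" if "m \<in> ?K" for m
        using m0 that X(3)[of m] X(3)[of m0] by (auto simp: L_def)
      have "(\<Sum>m\<in>L. c m * (if exps (X m) = x then 1 else 0))
          = (\<Sum>m\<in>?K. c m * (if exps (X m) = x then 1 else 0))"
      proof (rule sum.mono_neutral_left)
        show "\<forall>m\<in>?K - L. c m * (if exps (X m) = x then 1 else 0) = 0"
        proof
          fix m assume m: "m \<in> ?K - L"
          have "exps (X m) \<noteq> x"
          proof
            assume "exps (X m) = x"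
            then have "mon_weight triple_weight m = mon_weight triple_weight m0"
              using m m0 X(3)[of m] X(3)[of m0] by (auto simp: L_def)
            with m m0 show False by (auto simp: L_def)
          qed
          then show "c m * (if exps (X m) = x then 1 else 0) = 0" by simp
        qed
      qed (use \<open>L \<subseteq> ?K\<close> in auto)
      also have "\<dots> = (\<Sum>m\<in>?K. c m * Poly_Mapping.lookup (det_prod (X m) :: (nat \<times> nat, 'k) mpoly) x)"
      proof (intro sum.cong HOL.refl)
        fix m assume "m \<in> ?K"
        then show "c m * (if exps (X m) = x then 1 else 0) = c m * Poly_Mapping.lookup (det_prod (X m) :: (nat \<times> nat, 'k) mpoly) x"
          using leads_lookup[OF leads_det_prod[OF X(1)] le] by simp
      qed
      finally show ?thesis using sum0 by simp
    qed (simp add: sum.neutral)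
    finally show "Poly_Mapping.lookup (\<Sum>m\<in>L. scale (c m) (Poly_Mapping.single (exps (X m)) 1)) x
      = Poly_Mapping.lookup 0 x" by simp
  qed
  finally have "subst init_plucker (init_form triple_weight f) = 0" .
  moreover have "Poly_Mapping.keys (init_form triple_weight f) \<subseteq> ?K"
    by (auto simp: in_keys_iff lookup_init_form split: if_splits)
  ultimately show ?thesis
    using carr by (auto simp: toric_ideal_def in_carrier_iff)
qed

lemma lift_higher:
  assumes "f \<in> higher d t"
  obtains h where "h \<in> carrier (poly_ring (triples n))" "terms_above triple_weight t h" "subst plucker_form h = f"
proof -
  let ?T = "{f. \<exists>h. h \<in> carrier (poly_ring (triples n)) \<and> terms_above triple_weight t h \<and>
    subst plucker_form h = (f :: (nat \<times> nat, 'k) mpoly)}"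
  have "mpoly.subspace ?T"
  proof (intro mpoly.subspaceI)
    show "0 \<in> ?T" by (auto intro!: exI[of _ 0] carrier_zero simp: terms_above_def)
    fix f g \<sigma> assume "f \<in> ?T"
    then obtain h where h: "h \<in> carrier (poly_ring (triples n))" "terms_above triple_weight t h"
      "subst plucker_form h = f" by blast
    then show "scale \<sigma> f \<in> ?T"
      by (auto intro!: exI[of _ "scale \<sigma> h"] carrier_scale
          simp: subst_scale terms_above_def in_keys_iff lookup_scale)
    assume "g \<in> ?T"
    then obtain k where "k \<in> carrier (poly_ring (triples n))" "terms_above triple_weight t k"
      "subst plucker_form k = g" by blast
    with h show "f + g \<in> ?T"
      by (auto intro!: exI[of _ "h + k"] carrier_add terms_above_add simp: subst_add)
  qed
  moreover have "det_prod Z \<in> ?T" if Z: "set_mset Z \<subseteq> columns a n" "t < weight Z" for Z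
  proof -
    obtain \<sigma> m where "var_prod Z = Poly_Mapping.single m \<sigma>" "mon_weight triple_weight m = weight Z"
      using var_prod_monomial[OF Z(1)] by metis
    with Z show ?thesis
      by (auto intro!: exI[of _ "var_prod Z"] var_prod_carrier subst_plucker_var_prod simp: terms_above_def split: if_splits)
  qed
  ultimately have "higher d t \<subseteq> ?T"
    unfolding higher_def by (intro mpoly.span_minimal) auto
  with assms that show ?thesis by blast
qed

text \<open>By straightening, the image of \<open>b\<close> in the Pluecker algebra is also the image of some \<open>h\<close> all of
whose terms are heavier than those of \<open>b\<close>.  Then \<open>b - h\<close> lies in the Pluecker ideal and has initial form
\<open>b\<close>.\<close>

lemma toric_binomial_init_form:
  assumes "b \<in> toric_binomials"
  shows "b \<in> init_form triple_weight ` plucker_ideal n"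
proof -
  from assms obtain X Y where b: "b = var_prod X - var_prod Y" and X: "set_mset X \<subseteq> columns a n"
    and Y: "set_mset Y \<subseteq> columns a n" and XY: "exps X = exps Y"
    by (auto simp: toric_binomials_def)
  obtain h where h: "h \<in> carrier (poly_ring (triples n))" "terms_above triple_weight (weight X) h"
    "subst plucker_form h = (det_prod X - det_prod Y :: (nat \<times> nat, 'k) mpoly)"
    using equal_exps_in_higher[OF X Y XY] lift_higher by metis
  have "b - h \<in> plucker_ideal n"
    using h by (auto simp: in_plucker_ideal_iff b subst_diff subst_plucker_var_prod[OF X]
        subst_plucker_var_prod[OF Y] intro!: carrier_diff var_prod_carrier[OF X] var_prod_carrier[OF Y])
  moreover have "init_form triple_weight (b - h) = b"
  proof -
    have b_weight: "mon_weight triple_weight m = weight X" if m: "m \<in> Poly_Mapping.keys b" for m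
    proof -
      obtain \<sigma> x where x: "var_prod X = Poly_Mapping.single x \<sigma>" "mon_weight triple_weight x = weight X"
        using var_prod_monomial[OF X] by metis
      obtain \<tau> y where y: "var_prod Y = Poly_Mapping.single y \<tau>" "mon_weight triple_weight y = weight Y"
        using var_prod_monomial[OF Y] by metis
      show ?thesis
        using m x y XY by (auto simp: b in_keys_iff lookup_minus lookup_single when_def split: if_splits)
    qed
    have disj: "m \<notin> Poly_Mapping.keys h" if "m \<in> Poly_Mapping.keys b" for m
      using h(2) b_weight[OF that] by (auto simp: terms_above_def)
    have "b \<noteq> 0" using assms by (auto simp: toric_binomials_def)
    then obtain m0 where m0: "m0 \<in> Poly_Mapping.keys b" by (metis keys_eq_empty ex_in_conv)
    show ?thesis
    proof (rule poly_mapping_eqI)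
      fix m
      have m0': "m0 \<in> Poly_Mapping.keys (b - h)"
        using m0 disj[OF m0] by (simp add: in_keys_iff lookup_minus)
      have ge: "weight X \<le> mon_weight triple_weight m'" if m': "m' \<in> Poly_Mapping.keys (b - h)" for m'
      proof -
        have "m' \<in> Poly_Mapping.keys b \<or> m' \<in> Poly_Mapping.keys h"
          using m' by (auto simp: in_keys_iff lookup_minus)
        then show ?thesis using b_weight[of m'] h(2) by (auto simp: terms_above_def)
      qed
      show "Poly_Mapping.lookup (init_form triple_weight (b - h)) m = Poly_Mapping.lookup b m"
      proof (cases "m \<in> Poly_Mapping.keys b")
        case True
        then show ?thesis
          using ge b_weight[OF True] disj[OF True]
          by (simp add: lookup_init_form lookup_minus in_keys_iff)
      next
        case False
        show ?thesis
        proof (cases "m \<in> Poly_Mapping.keys h")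
          case True
          then have "mon_weight triple_weight m0 < mon_weight triple_weight m"
            using h(2) b_weight[OF m0] by (simp add: terms_above_def)
          with m0' have "\<not> (\<forall>m'\<in>Poly_Mapping.keys (b - h). mon_weight triple_weight m \<le> mon_weight triple_weight m')"
            by (meson not_le)
          with False show ?thesis by (auto simp: lookup_init_form in_keys_iff)
        next
          case h: False
          with False show ?thesis by (simp add: lookup_init_form lookup_minus in_keys_iff)
        qed
      qed
    qed
  qed
  ultimately show ?thesis by (metis imageI)
qed

lemma toric_ideal_kernel:
  "toric_ideal = a_kernel (poly_ring (triples n)) (poly_ring UNIV) (subst init_plucker)"
  by (simp add: toric_ideal_def a_kernel_def' poly_ring_simps)

lemma ideal_toric_ideal: "ideal toric_ideal (poly_ring (triples n))"
  unfolding toric_ideal_kernel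
proof (intro ring_hom_ring.kernel_is_ideal ring_hom_ringI)
  show "ring (poly_ring (triples n) :: (nat set, 'k) mpoly ring)"
    "ring (poly_ring UNIV :: (nat \<times> nat, 'k) mpoly ring)"
    using cring_poly_ring cring_def by blast+
qed (simp_all add: poly_ring_simps subst_add subst_mult in_carrier_iff)

text \<open>The kernel of a homomorphism to a domain.  That polynomials in the matrix variables form a domain
rests on the linear order of their exponents, which is induced by the lexicographic order of the index
pairs.\<close>

lemma primeideal_toric_ideal: "primeideal toric_ideal (poly_ring (triples n))"
proof (rule primeidealI[OF ideal_toric_ideal cring_poly_ring])
  have "(1 :: (nat set, 'k) mpoly) \<notin> toric_ideal" by (simp add: toric_ideal_def)
  then show "carrier (poly_ring (triples n)) \<noteq> toric_ideal" using carrier_one by blast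
next
  fix f g
  assume "f \<in> carrier (poly_ring (triples n))" "g \<in> carrier (poly_ring (triples n))"
    "f \<otimes>\<^bsub>poly_ring (triples n)\<^esub> g \<in> toric_ideal"
  then show "f \<in> toric_ideal \<or> g \<in> toric_ideal"
    by (simp add: toric_ideal_def poly_ring_simps subst_mult)
qed

lemma toric_ideal_subset_ideal:
  assumes J: "ideal J (poly_ring (triples n))" and B: "toric_binomials \<subseteq> J"
  shows "toric_ideal \<subseteq> J"
  unfolding toric_ideal_eq_span
proof (rule mpoly.span_minimal[OF B mpoly.subspaceI])
  interpret J: ideal J "poly_ring (triples n)" by fact
  show "0 \<in> J" using additive_subgroup.zero_closed[OF J.is_additive_subgroup] by (simp add: poly_ring_simps)
  fix f g \<sigma> assume f: "f \<in> J"
  show "scale \<sigma> f \<in> J"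
    using J.I_l_closed[OF f carrier_Const] by (simp add: poly_ring_simps scale_def)
  assume g: "g \<in> J"
  show "f + g \<in> J" using additive_subgroup.a_closed[OF J.is_additive_subgroup f g]
    by (simp add: poly_ring_simps)
qed

text \<open>Any set between the binomials and the kernel generates the kernel.  This is applied both to the
initial forms of the Pluecker ideal and to the binomials themselves.\<close>

lemma toric_ideal_genideal:
  assumes "toric_binomials \<subseteq> B" "B \<subseteq> toric_ideal"
  shows "genideal (poly_ring (triples n)) B = toric_ideal"
proof -
  interpret cring "poly_ring (triples n) :: (nat set, 'k) mpoly ring" by (rule cring_poly_ring)
  have carr: "B \<subseteq> carrier (poly_ring (triples n))"
    using assms(2) by (auto simp: toric_ideal_def)
  show ?thesis
  proof
    show "genideal (poly_ring (triples n)) B \<subseteq> toric_ideal"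
      by (rule genideal_minimal[OF ideal_toric_ideal assms(2)])
    show "toric_ideal \<subseteq> genideal (poly_ring (triples n)) B"
      using genideal_self[OF carr] assms(1)
      by (intro toric_ideal_subset_ideal[OF genideal_ideal[OF carr]]) blast
  qed
qed

theorem init_ideal_eq_toric_ideal:
  "init_ideal (triples n) triple_weight (plucker_ideal n) = toric_ideal"
  unfolding init_ideal_def
  using toric_binomial_init_form init_form_plucker_ideal by (intro toric_ideal_genideal) blast+

theorem binomial_ideal_toric_ideal: "binomial_ideal (triples n) toric_ideal"
  unfolding binomial_ideal_def
  using binomial_toric_binomial toric_binomials_subset toric_ideal_genideal[OF order_refl toric_binomials_subset]
  by (intro exI[of _ toric_binomials]) (auto simp: toric_ideal_def)

theorem span_init_forms_eq_subalg:
  "mpoly.span (init_form w ` plucker_algebra n) = subalg init_plucker (triples n)"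
proof
  have sub: "mpoly.subspace (subalg init_plucker (triples n))"
  proof (intro mpoly.subspaceI)
    show "0 \<in> subalg init_plucker (triples n)"
      unfolding subalg_def by (intro image_eqI[of _ _ 0]) (simp_all add: carrier_zero)
    fix f g \<sigma> assume "f \<in> subalg init_plucker (triples n)"
    then obtain p where p: "f = subst init_plucker p" "p \<in> carrier (poly_ring (triples n))"
      by (auto simp: subalg_def)
    then show "scale \<sigma> f \<in> subalg init_plucker (triples n)"
      unfolding subalg_def by (intro image_eqI[of _ _ "scale \<sigma> p"]) (simp_all add: subst_scale carrier_scale)
    assume "g \<in> subalg init_plucker (triples n)"
    then obtain q where "g = subst init_plucker q" "q \<in> carrier (poly_ring (triples n))"
      by (auto simp: subalg_def)
    with p show "f + g \<in> subalg init_plucker (triples n)"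
      unfolding subalg_def by (intro image_eqI[of _ _ "p + q"]) (simp_all add: subst_add carrier_add)
  qed
  have alg: "(plucker_algebra n :: (nat \<times> nat, 'k) mpoly set) \<subseteq> mpoly.span {det_prod X | X. set_mset X \<subseteq> columns a n}"
  proof
    fix f :: "(nat \<times> nat, 'k) mpoly" assume "f \<in> plucker_algebra n"
    then obtain p where p: "f = subst plucker_form p" "p \<in> carrier (poly_ring (triples n))"
      by (auto simp: plucker_algebra_def subalg_def)
    obtain S c where S: "finite S" "S \<subseteq> {X. set_mset X \<subseteq> columns a n}" "p = (\<Sum>X\<in>S. scale (c X) (var_prod X))"
      using carrier_in_span_var_prod[OF p(2)] by (rule span_image_explicit)
    have "f = (\<Sum>X\<in>S. scale (c X) (det_prod X))"
      unfolding p(1) S(3) subst_sum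
      by (intro sum.cong) (use S(2) in \<open>auto simp: subst_scale subst_plucker_var_prod\<close>)
    also have "\<dots> \<in> mpoly.span {det_prod X | X. set_mset X \<subseteq> columns a n}"
      using S(2) by (intro mpoly.span_sum mpoly.span_scale mpoly.span_base) auto
    finally show "f \<in> mpoly.span {det_prod X | X. set_mset X \<subseteq> columns a n}" .
  qed
  have mono: "Poly_Mapping.single (exps X) 1 \<in> subalg init_plucker (triples n)"
    if "set_mset X \<subseteq> columns a n" for X
    unfolding subalg_def using that
    by (intro image_eqI[of _ _ "var_prod X"]) (simp_all add: subst_init_var_prod var_prod_carrier)
  show "mpoly.span (init_form w ` plucker_algebra n) \<subseteq> subalg init_plucker (triples n)"
  proof (rule mpoly.span_minimal[OF _ sub], safe)
    fix f :: "(nat \<times> nat, 'k) mpoly" assume "f \<in> plucker_algebra n"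
    with alg have "init_form w f \<in> mpoly.span ((\<lambda>e. Poly_Mapping.single e 1) ` column_exps)"
      by (intro init_form_in_span) auto
    moreover have "mpoly.span ((\<lambda>e. Poly_Mapping.single e 1) ` column_exps) \<subseteq> subalg init_plucker (triples n)"
      using mono by (intro mpoly.span_minimal[OF _ sub]) (auto simp: column_exps_def)
    ultimately show "init_form w f \<in> subalg init_plucker (triples n)" by blast
  qed
  show "subalg init_plucker (triples n) \<subseteq> mpoly.span (init_form w ` plucker_algebra n)"
  proof
    fix f assume "f \<in> subalg init_plucker (triples n)"
    then obtain p where p: "f = subst init_plucker p" "p \<in> carrier (poly_ring (triples n))"
      by (auto simp: subalg_def)
    obtain S c where S: "finite S" "S \<subseteq> {X. set_mset X \<subseteq> columns a n}" "p = (\<Sum>X\<in>S. scale (c X) (var_prod X))"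
      using carrier_in_span_var_prod[OF p(2)] by (rule span_image_explicit)
    have "f = (\<Sum>X\<in>S. scale (c X) (init_form w (det_prod X)))"
      unfolding p(1) S(3) subst_sum
      by (intro sum.cong) (use S(2) in \<open>auto simp: subst_scale subst_init_var_prod init_form_of_leads[OF leads_det_prod]\<close>)
    also have "\<dots> \<in> mpoly.span (init_form w ` plucker_algebra n)"
    proof (intro mpoly.span_sum mpoly.span_scale mpoly.span_base imageI)
      fix X assume "X \<in> S"
      with S(2) have X: "set_mset X \<subseteq> columns a n" by blast
      show "det_prod X \<in> (plucker_algebra n :: (nat \<times> nat, 'k) mpoly set)"
        unfolding plucker_algebra_def subalg_def using X
        by (intro image_eqI[of _ _ "var_prod X"]) (simp_all add: subst_plucker_var_prod var_prod_carrier)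
    qed
    finally show "f \<in> mpoly.span (init_form w ` plucker_algebra n)" .
  qed
qed

end

section \<open>The block diagonal matching field\<close>

lemma block_diagonal_triple:
  assumes "x < y" "y < z" "1 \<le> x" "z \<le> a1 + a2"
  shows "block_diagonal a1 a2 {x, y, z} = (if precedes a1 x y then id else Transposition.transpose 1 2)"
proof (cases "x \<le> a1")
  case True
  have s: "(LEAST t. t \<in> {1, 2} \<and> block a1 a2 t \<inter> {x, y, z} \<noteq> {}) = 1"
    using True assms by (intro Least_equality) (auto simp: block_def)
  show ?thesis
  proof (cases "y \<le> a1")
    case y: True
    have "{x, y} \<subseteq> {x, y, z} \<inter> block a1 a2 1" using y True assms by (auto simp: block_def)
    then have "card {x, y} \<le> card ({x, y, z} \<inter> block a1 a2 1)" by (intro card_mono) auto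
    then have "2 \<le> card ({x, y, z} \<inter> block a1 a2 1)" using assms by simp
    then show ?thesis
      using y True assms unfolding block_diagonal_def s Let_def by (simp add: precedes_def)
  next
    case y: False
    have "{x, y, z} \<inter> block a1 a2 1 = {x}" using y True assms by (auto simp: block_def)
    then show ?thesis
      using y True assms unfolding block_diagonal_def s Let_def by (simp add: precedes_def)
  qed
next
  case False
  have s: "(LEAST t. t \<in> {1, 2} \<and> block a1 a2 t \<inter> {x, y, z} \<noteq> {}) = 2"
    using False assms by (intro Least_equality) (auto simp: block_def)
  have "{x, y, z} \<inter> block a1 a2 2 = {x, y, z}" using False assms by (auto simp: block_def)
  then have "2 \<le> card ({x, y, z} \<inter> block a1 a2 2)" using assms by simp
  then show ?thesis
    using False assms unfolding block_diagonal_def s Let_def by (simp add: precedes_def)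
qed

lemma sign_transpose_12: "sign (Transposition.transpose 1 (2::nat)) = - 1"
  by (simp add: sign_swap_id)

lemma single_col_exp:
  "Poly_Mapping.single (col_exp (p, q, r)) (1::'k::field) = Var (1, p) * Var (2, q) * Var (3, r)"
  by (simp add: Var_def mult_single)

lemma signed_mf_monomial:
  assumes "x < y" "y < z" "1 \<le> x" "z \<le> a1 + a2"
  shows "of_int (sign (block_diagonal a1 a2 {x, y, z})) * mf_monomial (block_diagonal a1 a2) {x, y, z} =
    (if precedes a1 x y then Poly_Mapping.single (col_exp (x, y, z)) (1::'k::field)
     else - Poly_Mapping.single (col_exp (y, x, z)) 1)"
proof -
  have cols: "Defs.col {x, y, z} (Suc 0) = x" "Defs.col {x, y, z} 2 = y" "Defs.col {x, y, z} 3 = z"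
    using sorted_list_of_three[OF assms(1,2)] by (simp_all add: Defs.col_def)
  have "{1..3::nat} = {1, 2, 3}" by auto
  then show ?thesis
    using sign_transpose_12
    by (simp add: mf_monomial_def block_diagonal_triple[OF assms] cols single_col_exp
        Transposition.transpose_def sign_id mult_ac del: col_exp.simps)
qed

text \<open>The three inequalities defining \<open>columns\<close> describe the block diagonal field: its sign and monomial
match those of the column determinant.\<close>

lemma induces_iff:
  "induces TYPE('k::field) (a1 + a2) M (block_diagonal a1 a2) \<longleftrightarrow>
    (\<forall>c\<in>columns a1 (a1 + a2). leads (case_prod M) (col_det c :: (nat \<times> nat, 'k) mpoly) (col_exp c))"
  (is "?L \<longleftrightarrow> ?R")
proof
  assume L: ?L
  show ?R
  proof
    fix c assume c: "c \<in> columns a1 (a1 + a2)"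
    obtain p q r where pqr: "c = (p, q, r)" by (cases c)
    from c have ineq: "p < r" "q < r" "p \<noteq> q" "1 \<le> p" "1 \<le> q" "r \<le> a1 + a2" "precedes a1 p q"
      by (auto simp: pqr columns_def precedes_def split: if_splits)
    have triple: "{p, q, r} \<in> triples (a1 + a2)"
      using ineq by (auto simp: triples_def card_insert_if)
    note init = L[unfolded induces_def, rule_format, OF triple]
    show "leads (case_prod M) (col_det c :: (nat \<times> nat, 'k) mpoly) (col_exp c)"
    proof (cases "p < q")
      case True
      with ineq init show ?thesis
        by (intro leads_of_init_form)
          (simp add: pqr plucker_form_sorted signed_mf_monomial del: col_det.simps col_exp.simps)
    next
      case False
      then have "q < p" "\<not> precedes a1 q p"
        using ineq by (auto simp: precedes_def split: if_splits)
      with ineq init show ?thesis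
        by (intro leads_of_init_form)
          (simp add: pqr insert_commute[of p q] plucker_form_sorted signed_mf_monomial
            col_det_swap12[of q p r] init_form_uminus del: col_det.simps col_exp.simps)
    qed
  qed
next
  assume R: ?R
  show ?L
    unfolding induces_def
  proof
    fix I assume "I \<in> triples (a1 + a2)"
    then obtain x y z where I: "I = {x, y, z}" and xyz: "x < y" "y < z" "1 \<le> x" "z \<le> a1 + a2"
      by (rule triple_sorted)
    show "init_form (case_prod M) (plucker_form I :: (nat \<times> nat, 'k) mpoly)
      = of_int (sign (block_diagonal a1 a2 I)) * mf_monomial (block_diagonal a1 a2) I"
    proof (cases "precedes a1 x y")
      case True
      with xyz have "(x, y, z) \<in> columns a1 (a1 + a2)" by (simp add: columns_def)
      with R have "init_form (case_prod M) (col_det (x, y, z)) = Poly_Mapping.single (col_exp (x, y, z)) (1::'k)"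
        by (intro init_form_of_leads) blast
      then show ?thesis
        unfolding I signed_mf_monomial[OF xyz] plucker_form_sorted[OF xyz(1,2)] using True by simp
    next
      case False
      with xyz have "(y, x, z) \<in> columns a1 (a1 + a2)"
        using precedes_total[of x y a1] by (auto simp: columns_def)
      with R have "init_form (case_prod M) (col_det (y, x, z)) = Poly_Mapping.single (col_exp (y, x, z)) (1::'k)"
        by (intro init_form_of_leads) blast
      moreover have "col_det (x, y, z) = (- col_det (y, x, z) :: (nat \<times> nat, 'k) mpoly)"
        by (rule col_det_swap12)
      ultimately show ?thesis
        unfolding I signed_mf_monomial[OF xyz] plucker_form_sorted[OF xyz(1,2)]
        using False by (simp add: init_form_uminus del: col_det.simps col_exp.simps)
    qed
  qed
qed

text \<open>A rank function for the order \<open>precedes a\<close>.\<close>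

definition block_rank :: "nat \<Rightarrow> nat \<Rightarrow> nat \<Rightarrow> nat" where
  "block_rank a n j = (if j \<le> a then n + j else j)"

text \<open>Entries up to \<open>n\<close> have rank at most \<open>2 * n\<close>, so the factor \<open>2 * n + 1\<close> lets the third row
dominate the second.\<close>

definition block_weight :: "nat \<Rightarrow> nat \<Rightarrow> weight_matrix" where
  "block_weight a n i j = (if i = 2 then - real (block_rank a n j)
     else if i = 3 then - real ((2 * n + 1) * j) else 0)"

text \<open>Among the six terms of the determinant, those without \<open>r\<close> in the third row are heavier because
\<open>r\<close> is the largest entry; the last competitor interchanges \<open>p\<close> and \<open>q\<close> and has the smaller rank in
the second row.\<close>

lemma leads_block_weight:
  assumes "c \<in> columns a n"
  shows "leads (case_prod (block_weight a n)) (col_det c :: (nat \<times> nat, 'k::field) mpoly) (col_exp c)"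
proof -
  obtain p q r where c: "c = (p, q, r)" by (cases c)
  from assms have ineq: "p < r" "q < r" "p \<noteq> q" "1 \<le> p" "1 \<le> q" "r \<le> n"
    and prec: "block_rank a n p < block_rank a n q"
    by (auto simp: c columns_def precedes_def block_rank_def split: if_splits)
  let ?w = "case_prod (block_weight a n)"
  have weight: "mon_weight ?w (col_exp (s, t, u)) = - real (block_rank a n t) - real ((2 * n + 1) * u)" for s t u
    by (simp add: mon_weight_add mon_weight_single block_weight_def)
  have rank_le: "block_rank a n j \<le> 2 * n" if "j \<le> n" for j
    using that by (auto simp: block_rank_def)
  have lower: "mon_weight ?w (col_exp (p, q, r)) < mon_weight ?w (col_exp (s, t, u))"
    if "u < r" "t \<le> n" for s t u
  proof -
    have "(2 * n + 1) * (u + 1) \<le> (2 * n + 1) * r" using that(1) by (intro mult_left_mono) auto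
    then have "block_rank a n t + (2 * n + 1) * u < block_rank a n q + (2 * n + 1) * r"
      using rank_le[OF that(2)] by (simp add: algebra_simps)
    then show ?thesis unfolding weight by linarith
  qed
  let ?x = "\<lambda>c. Poly_Mapping.single (col_exp c) (1::'k)"
  have det: "col_det (p, q, r) - ?x (p, q, r)
      = ?x (q, r, p) + ?x (r, p, q) - ?x (q, p, r) - ?x (p, r, q) - ?x (r, q, p)"
    unfolding single_col_exp by (simp add: algebra_simps)
  have ab: "terms_above ?w (mon_weight ?w (col_exp (p, q, r))) (?x d)"
    if "d \<in> {(q, r, p), (r, p, q), (q, p, r), (p, r, q), (r, q, p)}" for d
  proof (cases "d = (q, p, r)")
    case True
    then show ?thesis using prec by (simp only: terms_above_def weight True) (simp add: weight del: col_exp.simps)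
  next
    case False
    then show ?thesis
      using that ineq lower by (auto simp: terms_above_def simp del: col_exp.simps)
  qed
  show ?thesis
    unfolding c leads_def det by (intro terms_above_add terms_above_diff ab) auto
qed

lemma matching_field_block_diagonal: "is_matching_field (a1 + a2) (block_diagonal a1 a2)"
  unfolding is_matching_field_def
proof
  fix I assume "I \<in> triples (a1 + a2)"
  then obtain x y z where "I = {x, y, z}" "x < y" "y < z" "1 \<le> x" "z \<le> a1 + a2"
    by (rule triple_sorted)
  moreover have "Transposition.transpose 1 2 permutes {1..3::nat}"
    by (rule permutes_swap_id) auto
  ultimately show "block_diagonal a1 a2 I permutes {1..3}"
    by (simp add: block_diagonal_triple permutes_id)
qed

theorem corollary1p5:
  fixes n a1 a2 :: nat
  assumes "n \<ge> 3" and "a1 > 0" and "a2 > 0" and "a1 + a2 = n"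
  shows "coherent TYPE('k::field) n (block_diagonal a1 a2) \<and>
    (\<forall>M. induces TYPE('k) n M (block_diagonal a1 a2) \<longrightarrow>
       (primeideal (init_plucker_ideal n M :: (nat set, 'k) mpoly set) (poly_ring (triples n)) \<and>
        binomial_ideal (triples n) (init_plucker_ideal n M :: (nat set, 'k) mpoly set)) \<and>
       plucker_khovanskii TYPE('k) n M)"
proof (intro conjI allI impI)
  note induces = induces_iff[of a1 a2, unfolded assms(4)]
  have "induces TYPE('k) n (block_weight a1 n) (block_diagonal a1 a2)"
    unfolding induces using leads_block_weight by blast
  then show "coherent TYPE('k) n (block_diagonal a1 a2)"
    using matching_field_block_diagonal[of a1 a2] unfolding coherent_def assms(4) by blast
  fix M assume "induces TYPE('k) n M (block_diagonal a1 a2)"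
  then interpret leading_columns a1 n "case_prod M" "TYPE('k)"
    unfolding induces by unfold_locales blast
  have "plucker_weight TYPE('k) M = triple_weight"
    by (rule ext) (simp add: plucker_weight_def triple_weight_def)
  then have init: "(init_plucker_ideal n M :: (nat set, 'k) mpoly set) = toric_ideal"
    using init_ideal_eq_toric_ideal by (simp add: init_plucker_ideal_def)
  show "primeideal (init_plucker_ideal n M :: (nat set, 'k) mpoly set) (poly_ring (triples n))"
    unfolding init by (rule primeideal_toric_ideal)
  show "binomial_ideal (triples n) (init_plucker_ideal n M :: (nat set, 'k) mpoly set)"
    unfolding init by (rule binomial_ideal_toric_ideal)
  have "is_monomial_up_to_sign (init_plucker I)" if I: "I \<in> triples n" for I
  proof -
    obtain c where c: "c \<in> columns a1 n" "entries c = I" using I by (rule column_of_triple)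
    have "init_plucker I = Poly_Mapping.single (col_exp c) (col_sign c)"
      using init_plucker_entries[OF c(1)] c(2) by (simp add: scale_single)
    then show ?thesis
      using col_sign_cases[of c, where ?'k = 'k] by (auto simp: is_monomial_up_to_sign_def)
  qed
  then show "plucker_khovanskii TYPE('k) n M"
    using span_init_forms_eq_subalg by (simp add: plucker_khovanskii_def)
qed

end
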